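(* Let $N\ge 1$, let $\xi_1,\dots,\xi_N\in\mathbb R\setminus\{0\}$, and let $\tau=(\tau_i)_{i\ge1}$ be i.i.d. non-negative random variables on a probability space $(\Omega,\mathbb P)$ with common law $\rho$ having at most exponential tails and with $\mathbb E(\tau_i)=1$. Let $\Phi_t$ be the (almost everywhere defined) flow of the point vortex system with singular kernel $K$ and let $\Psi^m_t$, $m\in\mathbb N$, $m\ge1$, be the interpolated stochastic flow driven by $\tau$ (both defined in the context). Then for $dx^N\otimes\mathbb P$-almost every $(x,\omega)$, for all $t\in[0,1]$, $$\Psi^m_t(x)\to\Phi_t(x)\qquad\text{as } m\to\infty .$$
   Context: $\mathbb T\simeq[0,1)^2$ is the two-dimensional flat torus, $dx^N$ is the Lebesgue (Haar) measure on $\mathbb T^N$, and $\mathcal X:=\{x=(x_1,\dots,x_N)\in\mathbb T^N: x_i\ne x_j\ \forall i\neq j\}$, which has full measure. $\nabla^\perp=(-\partial_2,\partial_1)$. $G:\mathbb T\setminus\{0\}\to\mathbb R$ is the zero-average Green function of $-\Delta$ on $\mathbb T$ (so $-\Delta G=\delta_0-1$), and $K=-\nabla^\perp G:\mathbb T\setminus\{0\}\to\mathbb R^2$ is the Biot-Savart kernel. Point vortex system: $\dot x_i=v_i(x)$, $v_i(x)=\sum_{j\ne i}\xi_jK(x_i-x_j)$, $i=1,\dots,N$, for $x\in\mathcal X$. It is known (Dürr-Pulvirenti) that for $dx^N$-almost every initial condition $x\in\mathcal X$ this ODE system has a unique solution in $\mathcal X$, smooth and global in time; $\Phi_t(x)$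 denotes this solution at time $t$. Single-component vector fields: $v^{(i)}:=(0,\dots,0,v_i,0,\dots,0)$ on $\mathcal X$ ($v_i$ in the $i$-th slot), $i=1,\dots,N$. Its flow $\Phi^{(i)}_t$ is well defined on $\mathcal X$ for all times. For indices larger than $N$, the superscript $i$ is understood modulo $N$ with representatives in $\{1,\dots,N\}$. "At most exponential tails" means that there are constants $C,c>0$ with $\mathbb P(\tau_1>r)\le Ce^{-cr}$ for all $r\ge0$. The same sequence $\tau$ is used for all $m$. Interpolated stochastic flow: $t\mapsto\Psi^m_t(x)$ is the continuous, piecewise smooth solution of $\frac{d}{dt}\Psi^m_t(x)=N\tau_i\,v^{(j)}(\Psi^m_t(x))$, $\Psi^m_0(x)=x$, where $i=\lfloor Nmt\rfloor+1$ and $j\in\{1,\dots,N\}$, $j\equiv i\ (\mathrm{mod}\ N)$. In particular, if $mt$ is an integer, then $\Psi^m_t(x)=\Phi^{(\ell N)}_{\tau_{\ell N}/m}\circ\dots\circ\Phi^{(1)}_{\tau_1/m}(x)$ with $\ell=mt$. Convergence is in the standard topology of $\mathbb T^N$. *)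

theory Defs
  imports "HOL-Probability.Probability"
begin

section \<open>The flat torus\<close>

quotient_type torus = "real^2" / "\<lambda>x y. \<forall>i. x $ i - y $ i \<in> \<int>"
proof (rule equivpI)
  show "reflp (\<lambda>x y::real^2. \<forall>i. x $ i - y $ i \<in> \<int>)"
    by (auto intro: reflpI)
  show "symp (\<lambda>x y::real^2. \<forall>i. x $ i - y $ i \<in> \<int>)"
    by (rule sympI) (metis Ints_minus minus_diff_eq)
  show "transp (\<lambda>x y::real^2. \<forall>i. x $ i - y $ i \<in> \<int>)"
    by (rule transpI) (metis (no_types, lifting) Ints_add diff_add_cancel add_diff_eq)
qed

lift_definition tor :: "real^2 \<Rightarrow> torus" is "\<lambda>x. x" .

instantiation torus :: ab_group_add
begin
lift_definition zero_torus :: torus is "0" .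
lift_definition plus_torus :: "torus \<Rightarrow> torus \<Rightarrow> torus" is "(+)"
  by (metis (no_types, lifting) Ints_add add_diff_add vector_add_component)
lift_definition uminus_torus :: "torus \<Rightarrow> torus" is "uminus"
  by (metis (no_types, lifting) Ints_minus minus_diff_minus vector_uminus_component)
lift_definition minus_torus :: "torus \<Rightarrow> torus \<Rightarrow> torus" is "(-)"
proof -
  fix a b c d :: "real^2" and i :: 2
  assume "\<And>i. a $ i - b $ i \<in> \<int>" "\<And>i. c $ i - d $ i \<in> \<int>"
  then have "(a $ i - b $ i) - (c $ i - d $ i) \<in> \<int>" by (rule Ints_diff)
  then show "(a - c) $ i - (b - d) $ i \<in> \<int>" by (simp add: algebra_simps)
qed
instance
proof
  fix a b c :: torus
  show "a + b + c = a + (b + c)" by transfer (simp add: algebra_simps)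
  show "a + b = b + a" by transfer (simp add: algebra_simps)
  show "0 + a = a" by transfer simp
  show "- a + a = 0" by transfer simp
  show "a - b = a + - b" by transfer simp
qed
end

instantiation torus :: topological_space
begin
text \<open>The quotient topology of \<open>\<real>\<^sup>2 \<rightarrow> \<real>\<^sup>2/\<int>\<^sup>2\<close>.\<close>
definition open_torus :: "torus set \<Rightarrow> bool"
  where "open_torus U \<longleftrightarrow> open (tor -` U)"
instance by standard (auto simp: open_torus_def vimage_Union)
end

lemma continuous_on_tor: "continuous_on S tor"
  by (rule continuous_on_subset[of UNIV])
     (auto simp: continuous_on_open_vimage open_torus_def)

lemma tor_measurable [measurable]: "tor \<in> borel_measurable borel"
  by (rule borel_measurable_continuous_onI[OF continuous_on_tor])

definition unit_square :: "(real^2) set"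
  where "unit_square = {x. \<forall>i. 0 \<le> x $ i \<and> x $ i < 1}"

definition torus_measure :: "torus measure"
  where "torus_measure = distr (restrict_space lborel unit_square) borel tor"

lemma unit_square_sets [measurable]: "unit_square \<in> sets borel"
  unfolding unit_square_def by measurable

lemma space_torus_measure: "space torus_measure = UNIV"
  by (simp add: torus_measure_def)

lemma prob_space_torus_measure: "prob_space torus_measure"
proof -
  have "box 0 1 \<subseteq> unit_square" "unit_square \<subseteq> cbox 0 (1::real^2)"
    by (auto simp: unit_square_def mem_box_cart less_imp_le)
  then have "emeasure lborel (box 0 (1::real^2)) \<le> emeasure lborel unit_square"
    "emeasure lborel unit_square \<le> emeasure lborel (cbox 0 (1::real^2))"
    by (auto intro!: emeasure_mono)
  moreover have "emeasure lborel (box 0 (1::real^2)) = 1" "emeasure lborel (cbox 0 (1::real^2)) = 1"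
    by (auto simp: emeasure_lborel_box_eq emeasure_lborel_cbox_eq Basis_vec_def inner_axis
        intro!: prod.neutral)
  ultimately have "emeasure lborel unit_square = 1" by simp
  then have "prob_space (restrict_space lborel unit_square)"
    by (intro prob_spaceI) (simp add: emeasure_restrict_space space_restrict_space)
  then show ?thesis
    unfolding torus_measure_def
    by (rule prob_space.prob_space_distr) (simp add: measurable_restrict_space1)
qed

section \<open>Calculus on the torus\<close>

definition shift :: "torus \<Rightarrow> 2 \<Rightarrow> real \<Rightarrow> torus"
  where "shift x k s = x + tor (s *\<^sub>R axis k 1)"

definition partial :: "2 \<Rightarrow> (torus \<Rightarrow> real) \<Rightarrow> torus \<Rightarrow> real"
  where "partial k f x = deriv (\<lambda>s. f (shift x k s)) 0"

definition laplacian :: "(torus \<Rightarrow> real) \<Rightarrow> torus \<Rightarrow> real"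
  where "laplacian f x = (\<Sum>k\<in>UNIV. partial k (partial k f) x)"

definition perp_grad :: "(torus \<Rightarrow> real) \<Rightarrow> torus \<Rightarrow> real^2"
  where "perp_grad f x = vector [- partial 2 f x, partial 1 f x]"

fun Ck_on :: "nat \<Rightarrow> torus set \<Rightarrow> (torus \<Rightarrow> real) \<Rightarrow> bool" where
  "Ck_on 0 S f \<longleftrightarrow> continuous_on S f"
| "Ck_on (Suc n) S f \<longleftrightarrow> continuous_on S f \<and>
     (\<forall>k. (\<forall>x\<in>S. (\<lambda>s. f (shift x k s)) differentiable at 0) \<and> Ck_on n S (partial k f))"

definition smooth_on :: "torus set \<Rightarrow> (torus \<Rightarrow> real) \<Rightarrow> bool"
  where "smooth_on S f \<longleftrightarrow> (\<forall>n. Ck_on n S f)"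

text \<open>
  The zero-average solution of \<open>-\<Delta>G = \<delta>\<^sub>0 - 1\<close> in the sense of distributions. That equation only
  sees \<open>G\<close> almost everywhere; smoothness off the origin selects the representative that is defined
  pointwise on the punctured torus. The value \<open>G 0\<close> is irrelevant.
\<close>
definition green_function :: "(torus \<Rightarrow> real) \<Rightarrow> bool"
  where "green_function G \<longleftrightarrow>
    smooth_on (- {0}) G \<and>
    integrable torus_measure G \<and>
    (LINT x|torus_measure. G x) = 0 \<and>
    (\<forall>\<phi>. smooth_on UNIV \<phi> \<longrightarrow>
      (LINT x|torus_measure. G x * (- laplacian \<phi> x)) = \<phi> 0 - (LINT x|torus_measure. \<phi> x))"

definition biot_savart :: "(torus \<Rightarrow> real) \<Rightarrow> torus \<Rightarrow> real^2"
  where "biot_savart G x = - perp_grad G x"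

text \<open>
  On an interval \<open>S\<close>, a curve in the torus is differentiable with velocity \<open>w\<close> iff it has a lift
  to \<open>\<real>\<^sup>2\<close> with derivative \<open>w\<close>; derivatives are one-sided at end points belonging to \<open>S\<close>.
\<close>
definition has_velocity_on :: "(real \<Rightarrow> torus) \<Rightarrow> (real \<Rightarrow> real^2) \<Rightarrow> real set \<Rightarrow> bool"
  where "has_velocity_on c w S \<longleftrightarrow>
    (\<exists>y. \<forall>t\<in>S. c t = tor (y t) \<and> (y has_vector_derivative w t) (at t within S))"

section \<open>Point vortices\<close>

text \<open>Configurations of \<open>N\<close> vortices are functions on \<open>{1..N}\<close>, extended by \<open>undefined\<close>.\<close>

definition config_measure :: "nat \<Rightarrow> (nat \<Rightarrow> torus) measure"
  where "config_measure N = Pi\<^sub>M {1..N} (\<lambda>_. torus_measure)"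

definition configs :: "nat \<Rightarrow> (nat \<Rightarrow> torus) set"
  where "configs N = {x \<in> {1..N} \<rightarrow>\<^sub>E UNIV. \<forall>i\<in>{1..N}. \<forall>j\<in>{1..N}. i \<noteq> j \<longrightarrow> x i \<noteq> x j}"

definition vortex_velocity ::
  "nat \<Rightarrow> (nat \<Rightarrow> real) \<Rightarrow> (torus \<Rightarrow> real^2) \<Rightarrow> nat \<Rightarrow> (nat \<Rightarrow> torus) \<Rightarrow> real^2"
  where "vortex_velocity N \<xi> K i x = (\<Sum>j\<in>{1..N} - {i}. \<xi> j *\<^sub>R K (x i - x j))"

definition single_field ::
  "nat \<Rightarrow> (nat \<Rightarrow> real) \<Rightarrow> (torus \<Rightarrow> real^2) \<Rightarrow> nat \<Rightarrow> (nat \<Rightarrow> torus) \<Rightarrow> nat \<Rightarrow> real^2"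
  where "single_field N \<xi> K i x = (\<lambda>l. if l = i then vortex_velocity N \<xi> K i x else 0)"

definition vortex_solution ::
  "nat \<Rightarrow> (nat \<Rightarrow> real) \<Rightarrow> (torus \<Rightarrow> real^2) \<Rightarrow> (nat \<Rightarrow> torus) \<Rightarrow> (real \<Rightarrow> nat \<Rightarrow> torus) \<Rightarrow> bool"
  where "vortex_solution N \<xi> K x \<phi> \<longleftrightarrow>
    \<phi> 0 = x \<and> (\<forall>t\<ge>0. \<phi> t \<in> configs N) \<and>
    (\<forall>i\<in>{1..N}. has_velocity_on (\<lambda>t. \<phi> t i) (\<lambda>t. vortex_velocity N \<xi> K i (\<phi> t)) {0..})"

text \<open>
  Such a \<open>\<Phi>\<close> exists by the theorem of Duerr and Pulvirenti. It is determined for almost every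
  \<open>x\<close> and all \<open>t \<ge> 0\<close>, since the field is smooth on \<open>configs N\<close>.
\<close>
definition vortex_flow ::
  "nat \<Rightarrow> (nat \<Rightarrow> real) \<Rightarrow> (torus \<Rightarrow> real^2) \<Rightarrow> (real \<Rightarrow> (nat \<Rightarrow> torus) \<Rightarrow> (nat \<Rightarrow> torus)) \<Rightarrow> bool"
  where "vortex_flow N \<xi> K \<Phi> \<longleftrightarrow>
    (AE x in config_measure N. vortex_solution N \<xi> K x (\<lambda>t. \<Phi> t x))"

text \<open>
  The piece on which \<open>\<lfloor>N m t\<rfloor> = k\<close>, closed up, uses the time \<open>\<tau>\<^bsub>k+1\<^esub>\<close> and moves the vortex
  \<open>k mod N + 1\<close>, the representative of \<open>k + 1\<close> modulo \<open>N\<close> in \<open>{1..N}\<close>. Adjacent closed pieces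
  share an end point, so the curve is continuous.
\<close>
definition interpolated_solution ::
  "nat \<Rightarrow> (nat \<Rightarrow> real) \<Rightarrow> (torus \<Rightarrow> real^2) \<Rightarrow> (nat \<Rightarrow> real) \<Rightarrow> nat \<Rightarrow> (nat \<Rightarrow> torus) \<Rightarrow>
    (real \<Rightarrow> nat \<Rightarrow> torus) \<Rightarrow> bool"
  where "interpolated_solution N \<xi> K \<tau> m x \<psi> \<longleftrightarrow>
    \<psi> 0 = x \<and> (\<forall>t\<ge>0. \<psi> t \<in> configs N) \<and>
    (\<forall>k. \<forall>l\<in>{1..N}.
      has_velocity_on (\<lambda>t. \<psi> t l)
        (\<lambda>t. (real N * \<tau> (k + 1)) *\<^sub>R single_field N \<xi> K (k mod N + 1) (\<psi> t) l)
        {real k / (real N * real m) .. real (k + 1) / (real N * real m)})"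

definition stochastic_flow ::
  "nat \<Rightarrow> (nat \<Rightarrow> real) \<Rightarrow> (torus \<Rightarrow> real^2) \<Rightarrow> 'w measure \<Rightarrow> (nat \<Rightarrow> 'w \<Rightarrow> real) \<Rightarrow>
    (nat \<Rightarrow> 'w \<Rightarrow> real \<Rightarrow> (nat \<Rightarrow> torus) \<Rightarrow> (nat \<Rightarrow> torus)) \<Rightarrow> bool"
  where "stochastic_flow N \<xi> K M \<tau> \<Psi> \<longleftrightarrow>
    (\<forall>m\<ge>1. \<forall>\<omega>\<in>space M. \<forall>x\<in>configs N.
      interpolated_solution N \<xi> K (\<lambda>i. \<tau> i \<omega>) m x (\<lambda>t. \<Psi> m \<omega> t x))"

definition (in prob_space) exponential_tails :: "('a \<Rightarrow> real) \<Rightarrow> bool"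
  where "exponential_tails X \<longleftrightarrow>
    (\<exists>C>0. \<exists>c>0. \<forall>r\<ge>0. prob {\<omega> \<in> space M. X \<omega> > r} \<le> C * exp (- c * r))"

end

theory Submission
  imports Defs "HOL-Library.Discrete_Functions" "HOL-Real_Asymp.Real_Asymp"
begin

text \<open>
  The convergence is pathwise. Fix an initial condition whose vortex trajectory exists: on \<open>[0,1]\<close> it
  stays at positive distance from the collisions, and near it the velocity is Lipschitz. The
  interpolated flow solves \<open>y\<^sub>l' = A\<^sub>l' v\<^sub>l(y)\<close>, where the clock \<open>A\<^sub>l\<close> of vortex \<open>l\<close> runs at rate
  \<open>N \<tau>\<^sub>i\<close> on the pieces that move \<open>l\<close> and stands still otherwise. By the strong law of large numbers
  \<open>A\<^sub>l(t) \<rightarrow> t\<close> uniformly on \<open>[0,1]\<close> for almost every \<open>\<omega>\<close>, and a Gronwall argument turns uniform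
  convergence of the clocks into convergence of the trajectories. The strong law comes from second
  moments: they give convergence along squares, and non-negativity of \<open>\<tau>\<close> fills the gaps.
\<close>

section \<open>The Biot-Savart kernel off the origin\<close>

text \<open>The kernel is singular and nothing keeps the interpolated flow away from collisions a
  priori. Every Lipschitz bound is therefore one-sided: its base point lies on the limit curve, the
  other point merely near it, and a first-failure argument shows that the interpolated curve never
  leaves this tube. The rates of the clocks need not converge pointwise; only their integrals do. A
  Gronwall bound that contains |a - 1| would not become small, so an integration by parts, in the
  form of a correction term, moves the estimate from the rates to the clocks. The same
  \<open>\<tau>\<close> serves all m, so the clocks of stage m are built from the partial sums, up
  to index N * m, of one fixed sequence. This is why the strong law is stated as a bound e * k + C
  for all k at once: with k at most N * m it is uniform over the pieces. Curves in the torus cannot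
  be scaled or integrated there, so all estimates are made on lifts to the plane.\<close>

lemma tor_eq_iff: "tor x = tor y \<longleftrightarrow> (\<forall>i. x $ i - y $ i \<in> \<int>)"
  by transfer simp

lemma tor_add: "tor (x + y) = tor x + tor y"
  by transfer simp

lemma tor_diff: "tor (x - y) = tor x - tor y"
  by transfer simp

lemma tor_0: "tor 0 = 0"
  by transfer simp

lemma shift_tor: "shift (tor y) k s = tor (y + s *\<^sub>R axis k 1)"
  by (simp add: shift_def tor_add)

lemma open_tor_nonzero: "open {y. tor y \<noteq> 0}"
proof -
  have "closed {y::real^2. \<forall>i. y $ i \<in> \<int>}"
    by (intro closed_Collect_all closed_vimage[unfolded vimage_def] closed_Ints continuous_intros)
  moreover have "- {y::real^2. \<forall>i. y $ i \<in> \<int>} = {y. tor y \<noteq> 0}"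
    using tor_eq_iff[of _ 0] by (auto simp: tor_0)
  ultimately show ?thesis by (metis open_Compl)
qed

text \<open>Only derivatives along the axes are given. Hence p is joined to q by two axis-parallel
  segments, with the mean value inequality on each; both stay in a compact neighbourhood of C, where
  the partial derivatives are bounded.\<close>

lemma Lipschitz_near_compact_of_partials:
  fixes f :: "real^2 \<Rightarrow> real" and D :: "2 \<Rightarrow> real^2 \<Rightarrow> real"
  assumes "open U" "compact C" "C \<subseteq> U"
    and D: "\<And>k y. y \<in> U \<Longrightarrow> ((\<lambda>s. f (y + s *\<^sub>R axis k 1)) has_real_derivative D k y) (at 0)"
    and D_cont: "\<And>k. continuous_on U (D k)"
  shows "\<exists>L\<ge>0. \<exists>\<delta>>0. \<forall>p\<in>C. \<forall>q. norm (q - p) \<le> \<delta> \<longrightarrow> \<bar>f q - f p\<bar> \<le> L * norm (q - p)"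
proof -
  obtain \<epsilon> where \<epsilon>: "0 < \<epsilon>" "(\<Union>x\<in>C. cball x \<epsilon>) \<subseteq> U"
    using compact_subset_open_imp_cball_epsilon_subset[OF assms(2,1,3)] by blast
  define C' where "C' = {x + y |x y. x \<in> C \<and> y \<in> cball 0 \<epsilon>}"
  have C': "p + x \<in> C'" if "p \<in> C" "norm x \<le> \<epsilon>" for p x
    using that by (auto simp: C'_def)
  have "compact C'"
    unfolding C'_def by (intro compact_sums assms compact_cball)
  have "C' \<subseteq> U"
  proof
    fix u assume "u \<in> C'"
    then obtain x y where "u = x + y" "x \<in> C" "norm y \<le> \<epsilon>"
      by (auto simp: C'_def)
    then have "u \<in> cball x \<epsilon>" by (simp add: dist_norm)
    then show "u \<in> U" using \<epsilon>(2) \<open>x \<in> C\<close> by blast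
  qed
  have "compact (\<Union>k. D k ` C')"
    by (intro compact_UN compact_continuous_image finite continuous_on_subset[OF D_cont \<open>C' \<subseteq> U\<close>] \<open>compact C'\<close>)
  then have "bounded (\<Union>k. D k ` C')"
    by (rule compact_imp_bounded)
  then obtain B0 where B0: "\<forall>x\<in>(\<Union>k. D k ` C'). norm x \<le> B0"
    unfolding bounded_iff by (elim exE)
  \<comment> \<open>If C is empty, B0 may be negative, but the Lipschitz constant must not
    be.\<close>
  define B where "B = max B0 0"
  have B: "\<bar>D k x\<bar> \<le> B" if "x \<in> C'" for k x
  proof -
    have "D k x \<in> (\<Union>k. D k ` C')" using that by blast
    with B0 have "norm (D k x) \<le> B0" by (rule bspec)
    then show ?thesis by (simp add: B_def)
  qed
  have line: "\<bar>f (y + a *\<^sub>R axis k 1) - f y\<bar> \<le> B * \<bar>a\<bar>"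
    if seg: "\<And>s. \<bar>s\<bar> \<le> \<bar>a\<bar> \<Longrightarrow> y + s *\<^sub>R axis k 1 \<in> C'" for y a k
  proof -
    have der: "((\<lambda>s. f (y + s *\<^sub>R axis k 1)) has_real_derivative D k (y + s *\<^sub>R axis k 1))
        (at s within {-\<bar>a\<bar>..\<bar>a\<bar>})" if "s \<in> {-\<bar>a\<bar>..\<bar>a\<bar>}" for s
    proof -
      have "y + s *\<^sub>R axis k 1 \<in> U" using seg[of s] that \<open>C' \<subseteq> U\<close> by auto
      \<comment> \<open>D describes the line restarted at the current point; shifting the parameter
        turns this into the derivative at s.\<close>
      from D[OF this, of k]
      have "((\<lambda>h. f (y + (s + h) *\<^sub>R axis k 1)) has_real_derivative D k (y + s *\<^sub>R axis k 1)) (at 0)"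
        by (simp add: algebra_simps)
      then have "((\<lambda>s. f (y + s *\<^sub>R axis k 1)) has_real_derivative D k (y + s *\<^sub>R axis k 1)) (at s)"
        using DERIV_at_within_shift[of "\<lambda>s. f (y + s *\<^sub>R axis k 1)" _ s 0 UNIV] by simp
      then show ?thesis by (rule has_field_derivative_at_within)
    qed
    have "norm (f (y + a *\<^sub>R axis k 1) - f (y + 0 *\<^sub>R axis k 1)) \<le> B * norm (a - 0)"
      by (rule field_differentiable_bound[OF _ der]) (use seg in \<open>auto intro!: B\<close>)
    then show ?thesis by simp
  qed
  have decomp: "q = p + (q - p) $ 1 *\<^sub>R axis 1 1 + (q - p) $ 2 *\<^sub>R axis 2 1" for p q :: "real^2"
    by (simp add: vec_eq_iff forall_2 axis_def)
  show ?thesis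
  proof (intro exI conjI ballI allI impI)
    show "0 \<le> 2 * B" by (simp add: B_def)
    \<comment> \<open>Each leg has length at most \<epsilon> / 2, so the path through the corner c
      stays within \<epsilon> of p.\<close>
    show "0 < \<epsilon> / 2" using \<epsilon> by simp
    fix p q :: "real^2" assume p: "p \<in> C" and q: "norm (q - p) \<le> \<epsilon> / 2"
    define a where "a = (q - p) $ 1"
    define b where "b = (q - p) $ 2"
    define c where "c = p + a *\<^sub>R axis 1 1"
    have ab: "\<bar>a\<bar> \<le> norm (q - p)" "\<bar>b\<bar> \<le> norm (q - p)"
      unfolding a_def b_def by (rule component_le_norm_cart)+
    have "\<bar>f c - f p\<bar> \<le> B * \<bar>a\<bar>"
      unfolding c_def by (rule line) (use ab q \<epsilon> in \<open>auto intro!: C' p simp: norm_axis_1\<close>)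
    moreover have "\<bar>f (c + b *\<^sub>R axis 2 1) - f c\<bar> \<le> B * \<bar>b\<bar>"
    proof (rule line)
      fix s assume s: "\<bar>s\<bar> \<le> \<bar>b\<bar>"
      have "norm (a *\<^sub>R axis 1 1 + s *\<^sub>R axis 2 (1::real) :: real^2) \<le> \<bar>a\<bar> + \<bar>s\<bar>"
        by (rule norm_triangle_le) (simp add: norm_axis_1)
      then show "c + s *\<^sub>R axis 2 1 \<in> C'"
        using C'[OF p, of "a *\<^sub>R axis 1 1 + s *\<^sub>R axis 2 1"] s ab q by (simp add: c_def add.assoc)
    qed
    moreover have "c + b *\<^sub>R axis 2 1 = q"
      using decomp[of q p] by (simp add: c_def a_def b_def)
    moreover have "B * \<bar>a\<bar> \<le> B * norm (q - p)" "B * \<bar>b\<bar> \<le> B * norm (q - p)"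
      using ab by (auto intro!: mult_left_mono simp: B_def)
    ultimately show "\<bar>f q - f p\<bar> \<le> 2 * B * norm (q - p)"
      by (auto simp: algebra_simps)
  qed
qed

lemma continuous_on_tor_compose:
  "continuous_on S f \<Longrightarrow> continuous_on {y. tor y \<in> S} (\<lambda>y. f (tor y))"
  by (rule continuous_on_compose2[OF _ continuous_on_tor]) auto

text \<open>Seen through \<open>tor\<close>, the shifts that define \<open>partial\<close> are
  axis-parallel lines in the plane, so the planar estimate applies to the periodic function y
  \<mapsto> f (tor y).\<close>

lemma Ck_on_Suc_Lipschitz_near_compact:
  assumes "Ck_on (Suc 0) (- {0}) f" and C: "compact C" "C \<subseteq> {y. tor y \<noteq> 0}"
  shows "\<exists>L\<ge>0. \<exists>\<delta>>0. \<forall>p\<in>C. \<forall>q. norm (q - p) \<le> \<delta> \<longrightarrow>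
    \<bar>f (tor q) - f (tor p)\<bar> \<le> L * norm (q - p)"
proof (rule Lipschitz_near_compact_of_partials[where D = "\<lambda>k y. partial k f (tor y)", OF open_tor_nonzero C])
  show "((\<lambda>s. f (tor (y + s *\<^sub>R axis k 1))) has_real_derivative partial k f (tor y)) (at 0)"
    if "y \<in> {y. tor y \<noteq> 0}" for k y
    using assms(1) that unfolding partial_def shift_tor[symmetric]
    by (auto simp: DERIV_deriv_iff_real_differentiable)
  show "continuous_on {y. tor y \<noteq> 0} (\<lambda>y. partial k f (tor y))" for k
    using continuous_on_tor_compose[of "- {0}" "partial k f"] assms(1) by simp
qed

lemma biot_savart_eq:
  "biot_savart G x = partial 2 G x *\<^sub>R axis 1 1 - partial 1 G x *\<^sub>R axis 2 1"
  by (simp add: biot_savart_def perp_grad_def vec_eq_iff forall_2 axis_def)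

lemma continuous_on_biot_savart:
  assumes "smooth_on (- {0}) G"
  shows "continuous_on {y. tor y \<noteq> 0} (\<lambda>y. biot_savart G (tor y))"
proof -
  have "continuous_on (- {0}) (partial k G)" for k
    using assms[unfolded smooth_on_def, rule_format, of 1] by simp
  then have "continuous_on {y. tor y \<noteq> 0} (\<lambda>y. partial k G (tor y))" for k
    using continuous_on_tor_compose[of "- {0}" "partial k G"] by simp
  then show ?thesis
    unfolding biot_savart_eq by (intro continuous_intros)
qed

lemma biot_savart_Lipschitz_near_compact:
  assumes "smooth_on (- {0}) G" and C: "compact C" "C \<subseteq> {y. tor y \<noteq> 0}"
  obtains L \<delta> where "0 \<le> L" "0 < \<delta>"
    and "\<And>p q. p \<in> C \<Longrightarrow> norm (q - p) \<le> \<delta> \<Longrightarrow>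
      norm (biot_savart G (tor q) - biot_savart G (tor p)) \<le> L * norm (q - p)"
proof -
  \<comment> \<open>The kernel consists of first partials of G, so its Lipschitz bound uses the
    second ones.\<close>
  have "Ck_on (Suc 0) (- {0}) (partial k G)" for k
    using assms(1)[unfolded smooth_on_def, rule_format, of "Suc (Suc 0)"] by simp
  from Ck_on_Suc_Lipschitz_near_compact[OF this C]
  obtain L \<delta> where L: "\<And>k. 0 \<le> L k" "\<And>k. 0 < \<delta> k"
    and lip: "\<And>k p q. p \<in> C \<Longrightarrow> norm (q - p) \<le> \<delta> k \<Longrightarrow>
      \<bar>partial k G (tor q) - partial k G (tor p)\<bar> \<le> L k * norm (q - p)"
    by metis
  show ?thesis
  proof (rule that[of "L 2 + L 1" "min (\<delta> 2) (\<delta> 1)"])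
    fix p q assume pq: "p \<in> C" "norm (q - p) \<le> min (\<delta> 2) (\<delta> 1)"
    have "biot_savart G (tor q) - biot_savart G (tor p) =
        (partial 2 G (tor q) - partial 2 G (tor p)) *\<^sub>R axis 1 1
        - (partial 1 G (tor q) - partial 1 G (tor p)) *\<^sub>R axis 2 1"
      by (simp add: biot_savart_eq algebra_simps)
    also have "norm \<dots> \<le> \<bar>partial 2 G (tor q) - partial 2 G (tor p)\<bar> + \<bar>partial 1 G (tor q) - partial 1 G (tor p)\<bar>"
      by (rule order_trans[OF norm_triangle_ineq4]) (simp add: norm_axis_1)
    also have "\<dots> \<le> (L 2 + L 1) * norm (q - p)"
      using lip[OF pq(1), of q 2] lip[OF pq(1), of q 1] pq(2) by (simp add: algebra_simps)
    finally show "norm (biot_savart G (tor q) - biot_savart G (tor p)) \<le> (L 2 + L 1) * norm (q - p)" .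
  qed (use L in auto)
qed

section \<open>Gluing curves over a uniform partition\<close>

text \<open>Up to the constant of integration, \<open>glue H n f\<close> is the continuous curve whose increments on the
  \<open>k\<close>-th piece are those of \<open>f k\<close>. Clamping the time to the piece makes continuity immediate.\<close>

definition glue :: "real \<Rightarrow> nat \<Rightarrow> (nat \<Rightarrow> real \<Rightarrow> 'a::real_normed_vector) \<Rightarrow> real \<Rightarrow> 'a"
  where "glue H n f t =
    (\<Sum>k<n. f k (max (real k / H) (min (real (k + 1) / H) t)) - f k (real k / H))"

text \<open>Pieces before k are clamped to their right end and contribute a full increment; pieces
  after k are clamped to their left end and contribute zero. The induction starts at k + 1 pieces
  and adds the latter.\<close>

lemma glue_on_piece:
  assumes H: "0 < H" and "k < n" and t: "t \<in> {real k / H .. real (k + 1) / H}"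
  shows "glue H n f t =
    (\<Sum>i<k. f i (real (i + 1) / H) - f i (real i / H)) + (f k t - f k (real k / H))"
proof -
  have "Suc k \<le> n" using \<open>k < n\<close> by simp
  then show ?thesis
  proof (induction n rule: dec_induct)
    case base
    have past: "max (real i / H) (min (real (i + 1) / H) t) = real (i + 1) / H" if "i < k" for i
    proof -
      have "real (i + 1) / H \<le> real k / H" "real i / H \<le> real (i + 1) / H"
        using that H by (intro divide_right_mono; simp)+
      then show ?thesis using t by (simp only: atLeastAtMost_iff) linarith
    qed
    have "max (real k / H) (min (real (k + 1) / H) t) = t"
      using t by simp
    then show ?case
      using past by (simp add: glue_def)
  next
    case (step n)
    have "real (k + 1) / H \<le> real n / H" "real n / H \<le> real (n + 1) / H"
      using step(1) H by (intro divide_right_mono; simp)+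
    then have "max (real n / H) (min (real (n + 1) / H) t) = real n / H"
      using t by (simp only: atLeastAtMost_iff) linarith
    then show ?case
      using step.IH by (simp add: glue_def)
  qed
qed

lemma continuous_on_glue:
  assumes H: "0 < H" and "\<And>k. continuous_on {real k / H .. real (k + 1) / H} (f k)"
  shows "continuous_on S (glue H n f)"
  unfolding glue_def
proof (intro continuous_on_sum continuous_on_diff continuous_on_const)
  show "continuous_on S (\<lambda>t. f k (max (real k / H) (min (real (k + 1) / H) t)))" for k
    using H by (intro continuous_on_compose2[OF assms(2)] continuous_intros) (auto simp: divide_right_mono)
qed

text \<open>On an open piece the glued curve is f k up to a constant. At the joints the one-sided
  derivatives may differ.\<close>

lemma has_vector_derivative_glue:
  assumes H: "0 < H" and "k < n" and t: "t \<in> {real k / H <..< real (k + 1) / H}"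
    and f: "(f k has_vector_derivative d) (at t within {real k / H .. real (k + 1) / H})"
  shows "(glue H n f has_vector_derivative d) (at t)"
proof (rule has_vector_derivative_transform_within_open)
  let ?c = "(\<Sum>i<k. f i (real (i + 1) / H) - f i (real i / H)) - f k (real k / H)"
  have "(f k has_vector_derivative d) (at t)"
    using f t by (simp add: at_within_Icc_at)
  then show "((\<lambda>s. ?c + f k s) has_vector_derivative d) (at t)"
    by (auto intro!: derivative_eq_intros)
  show "?c + f k s = glue H n f s" if "s \<in> {real k / H <..< real (k + 1) / H}" for s
    using glue_on_piece[OF H \<open>k < n\<close>, of s f] that by simp
qed (use t in auto)

section \<open>A weighted strong law of large numbers\<close>

text \<open>A discrete layer-cake formula: the first k odd numbers add up to k squared, and with k
  the ceiling of x each layer n < k is reached.\<close>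

lemma square_le_layers:
  fixes x :: real
  assumes "0 \<le> x"
  shows "ennreal (x\<^sup>2) \<le> (\<Sum>n. ennreal (2 * real n + 1) * indicator {y. real n < y} x)"
proof -
  define k where "k = nat \<lceil>x\<rceil>"
  have k: "x \<le> real k" "\<And>n. n < k \<Longrightarrow> real n < x"
    using assms unfolding k_def by linarith+
  have sq: "(\<Sum>n<j. 2 * real n + 1) = (real j)\<^sup>2" for j
    by (induction j) (auto simp: power2_eq_square algebra_simps)
  have "ennreal (x\<^sup>2) \<le> ennreal (\<Sum>n<k. 2 * real n + 1)"
    unfolding sq using k(1) assms by (intro ennreal_leI power_mono)
  also have "\<dots> = (\<Sum>n<k. ennreal (2 * real n + 1) * indicator {y. real n < y} x)"
    by (subst sum_ennreal[symmetric]) (auto simp: k(2) intro!: sum.cong)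
  also have "\<dots> \<le> (\<Sum>n. ennreal (2 * real n + 1) * indicator {y. real n < y} x)"
    by (rule sum_le_suminf) auto
  finally show ?thesis .
qed

text \<open>The layers bound the second moment by the sum of (2n + 1) P(X > n), which the tails
  dominate by the derivative of a geometric series.\<close>

lemma (in prob_space) exponential_tails_integrable_square:
  fixes X :: "'a \<Rightarrow> real"
  assumes X [measurable]: "random_variable borel X"
    and nonneg: "AE \<omega> in M. 0 \<le> X \<omega>"
    and tails: "exponential_tails X"
  shows "integrable M (\<lambda>\<omega>. (X \<omega>)\<^sup>2)"
proof -
  obtain C c where "C > 0" "c > 0"
    and P: "\<And>r. r \<ge> 0 \<Longrightarrow> prob {\<omega> \<in> space M. X \<omega> > r} \<le> C * exp (- c * r)"
    using tails unfolding exponential_tails_def by blast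
  have "(\<integral>\<^sup>+\<omega>. ennreal ((X \<omega>)\<^sup>2) \<partial>M) \<le>
      (\<integral>\<^sup>+\<omega>. (\<Sum>n. ennreal (2 * real n + 1) * indicator {y. real n < y} (X \<omega>)) \<partial>M)"
  proof (rule nn_integral_mono_AE)
    show "AE \<omega> in M. ennreal ((X \<omega>)\<^sup>2) \<le>
        (\<Sum>n. ennreal (2 * real n + 1) * indicator {y. real n < y} (X \<omega>))"
      using nonneg
    proof eventually_elim
      case (elim \<omega>)
      then show ?case by (rule square_le_layers[of "X \<omega>"])
    qed
  qed
  also have "\<dots> = (\<Sum>n. \<integral>\<^sup>+\<omega>. ennreal (2 * real n + 1) * indicator {y. real n < y} (X \<omega>) \<partial>M)"
    by (rule nn_integral_suminf) measurable
  also have "\<dots> = (\<Sum>n. ennreal (2 * real n + 1) * emeasure M {\<omega> \<in> space M. X \<omega> > real n})"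
  proof (rule suminf_cong)
    fix n
    have "(\<integral>\<^sup>+\<omega>. ennreal (2 * real n + 1) * indicator {y. real n < y} (X \<omega>) \<partial>M) =
        (\<integral>\<^sup>+\<omega>. ennreal (2 * real n + 1) * indicator {\<omega> \<in> space M. X \<omega> > real n} \<omega> \<partial>M)"
      by (rule nn_integral_cong) (auto simp: indicator_def)
    also have "\<dots> = ennreal (2 * real n + 1) * emeasure M {\<omega> \<in> space M. X \<omega> > real n}"
      by (rule nn_integral_cmult_indicator) measurable
    finally show "(\<integral>\<^sup>+\<omega>. ennreal (2 * real n + 1) * indicator {y. real n < y} (X \<omega>) \<partial>M) = \<dots>" .
  qed
  also have "\<dots> \<le> (\<Sum>n. ennreal (2 * C * (real (Suc n) * exp (- c) ^ n)))"
  proof (rule suminf_le)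
    fix n
    \<comment> \<open>The factor is enlarged to 2n + 2 to produce the \<open>Suc n\<close> of
      \<open>geometric_deriv_sums\<close>.\<close>
    have "(2 * real n + 1) * prob {\<omega> \<in> space M. X \<omega> > real n} \<le> (2 * real n + 2) * (C * exp (- c * real n))"
      using P[of "real n"] by (intro mult_mono) auto
    also have "exp (- c * real n) = exp (- c) ^ n"
      by (simp add: exp_of_nat_mult[symmetric] mult.commute)
    finally have "(2 * real n + 1) * prob {\<omega> \<in> space M. X \<omega> > real n} \<le> 2 * C * (real (Suc n) * exp (- c) ^ n)"
      by (simp add: algebra_simps)
    moreover have "ennreal (2 * real n + 1) * emeasure M {\<omega> \<in> space M. X \<omega> > real n}
        = ennreal ((2 * real n + 1) * prob {\<omega> \<in> space M. X \<omega> > real n})"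
      unfolding emeasure_eq_measure by (rule ennreal_mult'[symmetric]) simp
    ultimately show "ennreal (2 * real n + 1) * emeasure M {\<omega> \<in> space M. X \<omega> > real n}
        \<le> ennreal (2 * C * (real (Suc n) * exp (- c) ^ n))"
      by (metis ennreal_leI)
  qed auto
  also have "\<dots> < \<infinity>"
  proof -
    have "summable (\<lambda>n. real (Suc n) * exp (- c) ^ n)"
      using geometric_deriv_sums[of "exp (- c)"] \<open>c > 0\<close> by (simp add: sums_iff)
    then have "summable (\<lambda>n. 2 * C * (real (Suc n) * exp (- c) ^ n))"
      by (rule summable_mult)
    then have "(\<Sum>n. ennreal (2 * C * (real (Suc n) * exp (- c) ^ n))) \<noteq> top"
      using \<open>C > 0\<close> by (intro ennreal_suminf_neq_top) simp_all
    then show ?thesis by (simp only: less_top infinity_ennreal_def)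
  qed
  finally show ?thesis
    by (intro integrableI_nonneg) auto
qed

text \<open>Between consecutive squares the sums can drop by at most the drift \<open>B\<close> per step, because the
  summands \<open>b i * x i\<close> are non-negative; the gap \<open>2 * n + 1\<close> is negligible against \<open>n\<^sup>2\<close>.\<close>

lemma interpolate_along_squares:
  fixes x b :: "nat \<Rightarrow> real"
  defines "s \<equiv> \<lambda>k. \<Sum>i<k. b i * (x i - 1)"
  assumes x: "\<And>i. 0 \<le> x i" and b: "\<And>i. 0 \<le> b i" "\<And>i. b i \<le> B"
    and lim: "(\<lambda>n. s (n\<^sup>2) / (real n)\<^sup>2) \<longlonglongrightarrow> 0" and e: "e > 0"
  shows "\<exists>C. \<forall>k. \<bar>s k\<bar> \<le> e * real k + C"
proof -
  \<comment> \<open>With (n + 1)^2 at most 2 n^2 + 2, the quarter becomes e / 2 at the next square;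
    the other half of e pays for the gap.\<close>
  have "\<forall>\<^sub>F n in sequentially. \<bar>s (n\<^sup>2) / (real n)\<^sup>2\<bar> < e / 4"
    using tendstoD[OF lim, of "e / 4"] e by (simp add: dist_real_def)
  then obtain n0 where n0: "\<And>n. n \<ge> n0 \<Longrightarrow> \<bar>s (n\<^sup>2) / (real n)\<^sup>2\<bar> < e / 4"
    by (auto simp: eventually_sequentially)
  \<comment> \<open>Absorbs the finitely many squares before n0, so that the bound \<open>sq\<close>
    holds for every n.\<close>
  define C1 where "C1 = (\<Sum>n\<in>{..n0}. \<bar>s (n\<^sup>2)\<bar>)"
  have "C1 \<ge> 0" by (auto simp: C1_def intro: sum_nonneg)
  have sq: "\<bar>s (n\<^sup>2)\<bar> \<le> e / 4 * (real n)\<^sup>2 + C1" for n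
  proof (cases "n > n0")
    case True
    then have "\<bar>s (n\<^sup>2)\<bar> / (real n)\<^sup>2 < e / 4" "real n > 0"
      using n0[of n] by (auto simp: abs_divide)
    then have "\<bar>s (n\<^sup>2)\<bar> < e / 4 * (real n)\<^sup>2"
      by (simp add: pos_divide_less_eq)
    then show ?thesis using \<open>C1 \<ge> 0\<close> by linarith
  next
    case False
    then have "\<bar>s (n\<^sup>2)\<bar> \<le> C1"
      unfolding C1_def by (intro member_le_sum) auto
    then show ?thesis using e by (smt (verit) zero_le_power2 mult_nonneg_nonneg divide_nonneg_nonneg)
  qed
  have "B \<ge> 0" using b order_trans by blast
  \<comment> \<open>One-sided: each summand is at least - b n, hence at least - B.\<close>
  have step: "s j - s i \<ge> - B * (real j - real i)" if "i \<le> j" for i j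
    using that
  proof (induction j rule: dec_induct)
    case (step n)
    have "b n * x n \<ge> 0" using b x by simp
    then have "b n * (x n - 1) \<ge> - B" using b(2)[of n] by (simp add: algebra_simps)
    then show ?case using step by (simp add: s_def algebra_simps)
  qed simp
  show ?thesis
  proof (intro exI allI)
    fix k
    define n where "n = floor_sqrt k"
    have n: "n\<^sup>2 \<le> k" "k \<le> (n + 1)\<^sup>2"
      using floor_sqrt_power2_le[of k] Suc_floor_sqrt_power2_gt[of k] unfolding n_def by auto
    have nr: "(real n)\<^sup>2 \<le> real k" "real k \<le> (real n + 1)\<^sup>2"
      using n by (metis of_nat_le_iff of_nat_power of_nat_add of_nat_1)+
    have gap: "(real n + 1)\<^sup>2 - (real n)\<^sup>2 = 2 * real n + 1"
      by (simp add: power2_eq_square algebra_simps)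
    \<comment> \<open>The drift bound is used twice: from the square below for the lower estimate,
      up to the square above for the upper one.\<close>
    have "s k \<ge> s (n\<^sup>2) - B * (real k - (real n)\<^sup>2)" "s k \<le> s ((n+1)\<^sup>2) + B * ((real n + 1)\<^sup>2 - real k)"
      using step[OF n(1)] step[OF n(2)] by (simp_all add: add.commute)
    moreover have "B * (real k - (real n)\<^sup>2) \<le> B * (2 * real n + 1)"
      "B * ((real n + 1)\<^sup>2 - real k) \<le> B * (2 * real n + 1)"
      using nr gap \<open>B \<ge> 0\<close> by (intro mult_left_mono; linarith)+
    moreover have "(real n + 1)\<^sup>2 \<le> 2 * (real n)\<^sup>2 + 2"
      using zero_le_power2[of "real n - 1"] by (simp add: power2_eq_square algebra_simps)
    then have "e / 4 * (real n + 1)\<^sup>2 \<le> e / 4 * (2 * (real n)\<^sup>2 + 2)"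
      using e by (intro mult_left_mono) auto
    moreover have "e / 4 * (real n)\<^sup>2 \<le> e / 4 * (2 * (real n)\<^sup>2 + 2)"
      using e by (intro mult_left_mono) auto
    \<comment> \<open>Young's inequality: completing the square trades the linear term 2 B n for e /
      2 * n^2 plus a constant.\<close>
    moreover have "B * (2 * real n + 1) \<le> e / 2 * (real n)\<^sup>2 + 2 * B\<^sup>2 / e + B"
    proof -
      have "0 \<le> (e * real n - 2 * B)\<^sup>2 / (2 * e)" using e by simp
      also have "\<dots> = e / 2 * (real n)\<^sup>2 + 2 * B\<^sup>2 / e - 2 * B * real n"
        using e by (simp add: field_simps power2_eq_square)
      finally show ?thesis by (simp add: algebra_simps)
    qed
    moreover have "e * (real n)\<^sup>2 \<le> e * real k" using nr e by simp
    moreover have "\<bar>s ((n+1)\<^sup>2)\<bar> \<le> e / 4 * (real n + 1)\<^sup>2 + C1" using sq[of "n + 1"] by (simp add: add.commute)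
    ultimately show "\<bar>s k\<bar> \<le> e * real k + (C1 + e / 2 + 2 * B\<^sup>2 / e + B)"
      using sq[of n] by (simp add: algebra_simps)
  qed
qed

text \<open>Independent centred variables are orthogonal, so only the diagonal of the expanded
  square survives. Integrability is part of the claim because the expectation of a non-integrable
  function is 0 by convention.\<close>

lemma (in prob_space) indep_centered_sum_square:
  fixes Y :: "nat \<Rightarrow> 'a \<Rightarrow> real"
  assumes indep: "indep_vars (\<lambda>_. borel) Y UNIV"
    and int: "\<And>i. integrable M (Y i)" and mean: "\<And>i. expectation (Y i) = 0"
    and int2: "\<And>i. integrable M (\<lambda>\<omega>. (Y i \<omega>)\<^sup>2)"
  shows "integrable M (\<lambda>\<omega>. (\<Sum>i<k. Y i \<omega>)\<^sup>2)"
    and "expectation (\<lambda>\<omega>. (\<Sum>i<k. Y i \<omega>)\<^sup>2) = (\<Sum>i<k. expectation (\<lambda>\<omega>. (Y i \<omega>)\<^sup>2))"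
proof -
  have off: "integrable M (\<lambda>\<omega>. Y i \<omega> * Y j \<omega>) \<and> expectation (\<lambda>\<omega>. Y i \<omega> * Y j \<omega>) = 0"
    if "i \<noteq> j" for i j
  proof -
    have ind: "indep_vars (\<lambda>_. borel) Y {i, j}"
      using indep by (rule indep_vars_subset) simp
    have "(\<Prod>l\<in>{i,j}. Y l \<omega>) = Y i \<omega> * Y j \<omega>" for \<omega>
      using that by simp
    then show ?thesis
      using indep_vars_integrable[OF _ ind int] indep_vars_lebesgue_integral[OF _ ind int] that
      by (simp add: mean)
  qed
  have prod_int: "integrable M (\<lambda>\<omega>. Y i \<omega> * Y j \<omega>)" for i j
    using off[of i j] int2[of i] by (cases "i = j") (auto simp: power2_eq_square)
  have sq: "(\<Sum>i<k. Y i \<omega>)\<^sup>2 = (\<Sum>i<k. \<Sum>j<k. Y i \<omega> * Y j \<omega>)" for \<omega>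
    by (simp add: power2_eq_square sum_product)
  show "integrable M (\<lambda>\<omega>. (\<Sum>i<k. Y i \<omega>)\<^sup>2)"
    unfolding sq by (intro Bochner_Integration.integrable_sum prod_int)
  have "expectation (\<lambda>\<omega>. (\<Sum>i<k. Y i \<omega>)\<^sup>2) = (\<Sum>i<k. \<Sum>j<k. expectation (\<lambda>\<omega>. Y i \<omega> * Y j \<omega>))"
    unfolding sq by (simp add: Bochner_Integration.integral_sum prod_int)
  also have "\<dots> = (\<Sum>i<k. \<Sum>j<k. if j = i then expectation (\<lambda>\<omega>. (Y i \<omega>)\<^sup>2) else 0)"
    using off by (intro sum.cong refl) (auto simp: power2_eq_square)
  also have "\<dots> = (\<Sum>i<k. expectation (\<lambda>\<omega>. (Y i \<omega>)\<^sup>2))"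
    by simp
  finally show "expectation (\<lambda>\<omega>. (\<Sum>i<k. Y i \<omega>)\<^sup>2) = (\<Sum>i<k. expectation (\<lambda>\<omega>. (Y i \<omega>)\<^sup>2))" .
qed

text \<open>The mean of k terms has second moment at most V / k, which is summable along k = n^2.
  The squared means then have a sum with finite expectation, so almost surely they tend to
  0.\<close>

lemma (in prob_space) weighted_sums_along_squares:
  fixes Y :: "nat \<Rightarrow> 'a \<Rightarrow> real"
  assumes indep: "indep_vars (\<lambda>_. borel) Y UNIV"
    and int: "\<And>i. integrable M (Y i)" and mean: "\<And>i. expectation (Y i) = 0"
    and int2: "\<And>i. integrable M (\<lambda>\<omega>. (Y i \<omega>)\<^sup>2)" and V: "\<And>i. expectation (\<lambda>\<omega>. (Y i \<omega>)\<^sup>2) \<le> V"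
  shows "AE \<omega> in M. (\<lambda>n. (\<Sum>i<n\<^sup>2. Y i \<omega>) / (real n)\<^sup>2) \<longlonglongrightarrow> 0"
proof -
  \<comment> \<open>Starting at \<open>Suc n\<close> avoids the division by zero at n = 0.\<close>
  define g where "g n \<omega> = ((\<Sum>i<(Suc n)\<^sup>2. Y i \<omega>) / (real (Suc n))\<^sup>2)\<^sup>2" for n \<omega>
  have [measurable]: "random_variable borel (Y i)" for i
    using int by auto
  have g_meas [measurable]: "random_variable borel (g n)" for n
    unfolding g_def by measurable
  have "V \<ge> 0" 
  proof -
    have "0 \<le> expectation (\<lambda>\<omega>. (Y 0 \<omega>)\<^sup>2)" by (rule Bochner_Integration.integral_nonneg) simp
    then show ?thesis using V[of 0] by linarith
  qed
  have "(\<integral>\<^sup>+\<omega>. ennreal (g n \<omega>) \<partial>M) \<le> ennreal (V * inverse ((real (Suc n))\<^sup>2))" for n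
  proof -
    have "expectation (g n) = (\<Sum>i<(Suc n)\<^sup>2. expectation (\<lambda>\<omega>. (Y i \<omega>)\<^sup>2)) / (real (Suc n))^4"
      unfolding g_def power_divide
      by (simp only: integral_divide_zero indep_centered_sum_square[OF indep int mean int2]
          power_mult[symmetric]) simp
    also have "\<dots> \<le> (real (Suc n))\<^sup>2 * V / (real (Suc n))^4"
      using sum_bounded_above[of "{..<(Suc n)\<^sup>2}" "\<lambda>i. expectation (\<lambda>\<omega>. (Y i \<omega>)\<^sup>2)" V] V
      by (intro divide_right_mono) auto
    also have "\<dots> = V * inverse ((real (Suc n))\<^sup>2)"
      by (simp add: field_simps power2_eq_square power4_eq_xxxx del: of_nat_Suc)
    finally have "expectation (g n) \<le> V * inverse ((real (Suc n))\<^sup>2)" .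
    moreover have "integrable M (g n)"
      unfolding g_def power_divide
      by (intro integrable_divide indep_centered_sum_square[OF indep int mean int2])
    ultimately show ?thesis
      by (subst nn_integral_eq_integral) (auto simp: g_def intro: ennreal_leI)
  qed
  then have "(\<integral>\<^sup>+\<omega>. (\<Sum>n. ennreal (g n \<omega>)) \<partial>M) \<le> (\<Sum>n. ennreal (V * inverse ((real (Suc n))\<^sup>2)))"
    by (subst nn_integral_suminf) (auto intro!: suminf_le)
  also have "\<dots> < \<infinity>"
  proof -
    have "summable (\<lambda>n. inverse ((real (Suc n))\<^sup>2))"
      by (rule summable_Suc_iff[THEN iffD2, OF inverse_power_summable]) simp
    then have "(\<Sum>n. ennreal (V * inverse ((real (Suc n))\<^sup>2))) \<noteq> top"
      using \<open>V \<ge> 0\<close> by (intro ennreal_suminf_neq_top summable_mult mult_nonneg_nonneg) simp_all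
    then show ?thesis by (simp only: less_top infinity_ennreal_def)
  qed
  finally have "AE \<omega> in M. (\<Sum>n. ennreal (g n \<omega>)) \<noteq> \<infinity>"
    by (intro nn_integral_PInf_AE) auto
  then show ?thesis
  proof eventually_elim
    case (elim \<omega>)
    then have "summable (\<lambda>n. g n \<omega>)"
      by (intro summable_suminf_not_top) (auto simp: g_def)
    then have "(\<lambda>n. g n \<omega>) \<longlonglongrightarrow> 0"
      by (rule summable_LIMSEQ_zero)
    then have "(\<lambda>n. (\<Sum>i<(Suc n)\<^sup>2. Y i \<omega>) / (real (Suc n))\<^sup>2) \<longlonglongrightarrow> 0"
      unfolding g_def by (subst (asm) power_tendsto_0_iff) auto
    then show ?case
      using filterlim_sequentially_Suc[of "\<lambda>n. (\<Sum>i<n\<^sup>2. Y i \<omega>) / (real n)\<^sup>2"] by blast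
  qed
qed

text \<open>The weights serve to select a residue class later without thinning the sequence. All e
  share one null set, because the passage from squares to all k is made pathwise.\<close>

lemma (in prob_space) weighted_strong_law:
  fixes X :: "nat \<Rightarrow> 'a \<Rightarrow> real"
  assumes indep: "indep_vars (\<lambda>_. borel) X UNIV"
    and nonneg: "\<And>i. AE \<omega> in M. 0 \<le> X i \<omega>"
    and mean: "\<And>i. expectation (X i) = 1"
    and int2: "\<And>i. integrable M (\<lambda>\<omega>. (X i \<omega>)\<^sup>2)" and V: "\<And>i. expectation (\<lambda>\<omega>. (X i \<omega>)\<^sup>2) \<le> V"
    and b: "\<And>i. 0 \<le> b i" "\<And>i. b i \<le> B"
  shows "AE \<omega> in M. \<forall>e>0. \<exists>C. \<forall>k. \<bar>\<Sum>i<k. b i * (X i \<omega> - 1)\<bar> \<le> e * real k + C"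
proof -
  \<comment> \<open>A non-integrable function has expectation 0, so the mean 1 forces
    integrability.\<close>
  have int: "integrable M (X i)" for i
    using mean[of i] not_integrable_integral_eq by fastforce
  define Y where "Y = (\<lambda>i \<omega>. b i * (X i \<omega> - 1))"
  have sqY: "(Y i \<omega>)\<^sup>2 = (b i)\<^sup>2 * ((X i \<omega>)\<^sup>2 - 2 * X i \<omega> + 1)" for i \<omega>
    by (simp add: Y_def power_mult_distrib power2_diff)
  have "indep_vars (\<lambda>_. borel) Y UNIV"
    unfolding Y_def by (rule indep_vars_compose2[OF indep]) measurable
  moreover have "integrable M (Y i)" "expectation (Y i) = 0" "integrable M (\<lambda>\<omega>. (Y i \<omega>)\<^sup>2)" for i
    using int int2 mean unfolding sqY unfolding Y_def by (auto simp: prob_space)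
  moreover have "expectation (\<lambda>\<omega>. (Y i \<omega>)\<^sup>2) \<le> B\<^sup>2 * V" for i
  proof -
    have "expectation (\<lambda>\<omega>. (Y i \<omega>)\<^sup>2) = (b i)\<^sup>2 * (expectation (\<lambda>\<omega>. (X i \<omega>)\<^sup>2) - 1)"
      unfolding sqY using int int2 mean by (simp add: prob_space)
    also have "\<dots> \<le> (b i)\<^sup>2 * V" using V[of i] by (intro mult_left_mono) auto
    also have "\<dots> \<le> B\<^sup>2 * V"
    proof -
      have "0 \<le> expectation (\<lambda>\<omega>. (X i \<omega>)\<^sup>2)" by (rule Bochner_Integration.integral_nonneg) simp
      then have "0 \<le> V" using V[of i] by linarith
      then show ?thesis using b by (intro mult_right_mono power_mono) auto
    qed
    finally show ?thesis .
  qed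
  ultimately have "AE \<omega> in M. (\<lambda>n. (\<Sum>i<n\<^sup>2. Y i \<omega>) / (real n)\<^sup>2) \<longlonglongrightarrow> 0"
    by (rule weighted_sums_along_squares)
  moreover have "AE \<omega> in M. \<forall>i. 0 \<le> X i \<omega>"
    using nonneg by (simp add: AE_all_countable)
  ultimately show ?thesis
  proof eventually_elim
    case (elim \<omega>)
    then show ?case
      using interpolate_along_squares[of "\<lambda>i. X i \<omega>" b B] b unfolding Y_def by blast
  qed
qed

section \<open>An averaging principle for fast switching\<close>

text \<open>A mean value inequality that tolerates kinks: for the gauge integral, continuity and a
  derivative off a finite set suffice for the fundamental theorem, so the pointwise inequality can
  be integrated.\<close>

lemma piecewise_derivative_bound:
  fixes f :: "real \<Rightarrow> 'a::euclidean_space" and g :: "real \<Rightarrow> real"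
  assumes F: "finite F" and "a \<le> b"
    and cont: "continuous_on {a..b} f" "continuous_on {a..b} g"
    and f': "\<And>s. s \<in> {a<..<b} - F \<Longrightarrow> (f has_vector_derivative f' s) (at s)"
    and g': "\<And>s. s \<in> {a<..<b} - F \<Longrightarrow> (g has_real_derivative g' s) (at s)"
    and le: "\<And>s. s \<in> {a<..<b} - F \<Longrightarrow> norm (f' s) \<le> g' s"
  shows "norm (f b - f a) \<le> g b - g a"
proof -
  define F' where "F' = F \<union> {a, b}"
  \<comment> \<open>Zero at the exceptional points, so that the norm inequality holds at every point
    of the interval.\<close>
  define f0 where "f0 s = (if s \<in> F' then 0 else f' s)" for s
  define g0 where "g0 s = (if s \<in> F' then 0 else g' s)" for s
  have F': "finite F'" using F by (simp add: F'_def)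
  have "(f0 has_integral (f b - f a)) {a..b}"
    by (rule fundamental_theorem_of_calculus_interior_strong[OF F' \<open>a \<le> b\<close> _ cont(1)])
       (auto simp: f0_def F'_def intro: f')
  moreover have "(g0 has_integral (g b - g a)) {a..b}"
    by (rule fundamental_theorem_of_calculus_interior_strong[OF F' \<open>a \<le> b\<close> _ cont(2)])
       (auto simp: g0_def F'_def has_real_derivative_iff_has_vector_derivative[symmetric] intro: g')
  moreover have "norm (f0 s) \<le> g0 s" if "s \<in> {a..b}" for s
    using le[of s] that by (auto simp: f0_def g0_def F'_def)
  ultimately show ?thesis
    using Henstock_Kurzweil_Integration.integral_norm_bound_integral[of f0 "{a..b}" g0]
    by (metis has_integral_integrable_integral)
qed

text \<open>Continuous induction. Strictness of the inequality makes the set of failures closed, so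
  it would have a least element, where \<open>step\<close> applies. At time 0 the premise of
  \<open>step\<close> is vacuous, which supplies the base case.\<close>

lemma first_failure:
  fixes w :: "'i \<Rightarrow> real \<Rightarrow> 'a::real_normed_vector" and u :: "real \<Rightarrow> real"
  assumes I: "finite I"
    and cont: "\<And>l. l \<in> I \<Longrightarrow> continuous_on {0..1} (w l)" "continuous_on {0..1} u"
    and step: "\<And>l t. l \<in> I \<Longrightarrow> t \<in> {0..1} \<Longrightarrow> (\<And>j s. j \<in> I \<Longrightarrow> s \<in> {0..<t} \<Longrightarrow> norm (w j s) < u s)
        \<Longrightarrow> norm (w l t) < u t"
    and "l \<in> I" "t \<in> {0..1}"
  shows "norm (w l t) < u t"
proof (rule ccontr)
  assume neg: "\<not> norm (w l t) < u t"
  define T where "T = (\<Union>j\<in>I. {0..1} \<inter> (\<lambda>s. norm (w j s) - u s) -` {0..})"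
  have "closed T"
    unfolding T_def
    by (intro closed_UN I ballI continuous_closed_preimage continuous_on_diff continuous_on_norm cont) auto
  moreover have "t \<in> T" "bdd_below T"
    using neg assms(5,6) by (auto simp: T_def not_less intro!: bdd_belowI[of _ 0])
  ultimately have Inf: "Inf T \<in> T"
    by (intro closed_contains_Inf) auto
  then obtain j where j: "j \<in> I" "Inf T \<in> {0..1}" "u (Inf T) \<le> norm (w j (Inf T))"
    by (auto simp: T_def)
  have "norm (w i s) < u s" if "i \<in> I" "s \<in> {0..<Inf T}" for i s
  proof (rule ccontr)
    assume "\<not> norm (w i s) < u s"
    then have "s \<in> T" using that j(2) by (auto simp: T_def not_less)
    then show False using cInf_lower[OF _ \<open>bdd_below T\<close>] that by force
  qed
  then show False
    using step[OF j(1,2)] j(3) by fastforce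
qed

text \<open>The correction term \<open>(A l t - t) *\<^sub>R p l t\<close> absorbs the fast oscillation of the rates: what
  remains in the derivative of \<open>w l\<close> is either Lipschitz in the error or small.\<close>
lemma averaging_estimate:
  fixes y z p p' :: "'i \<Rightarrow> real \<Rightarrow> 'a::euclidean_space"
    and v :: "'i \<Rightarrow> ('i \<Rightarrow> 'a) \<Rightarrow> 'a" and A a :: "'i \<Rightarrow> real \<Rightarrow> real"
  assumes I: "finite I" and F: "finite F"
    and pos: "0 \<le> L" "0 < \<eta>" "0 \<le> \<epsilon>" "\<epsilon> \<le> 1" "0 \<le> P" "0 \<le> Q"
    and z: "\<And>l t. l \<in> I \<Longrightarrow> t \<in> {0..1} \<Longrightarrow> (z l has_vector_derivative v l (\<lambda>j. z j t)) (at t within {0..1})"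
    and lip: "\<And>l t r x. l \<in> I \<Longrightarrow> t \<in> {0..1} \<Longrightarrow> r \<le> \<delta> \<Longrightarrow> (\<And>j. j \<in> I \<Longrightarrow> norm (x j - z j t) \<le> r)
        \<Longrightarrow> norm (v l x - v l (\<lambda>j. z j t)) \<le> L * r"
    and p: "\<And>l t. l \<in> I \<Longrightarrow> t \<in> {0..1} \<Longrightarrow> norm (v l (\<lambda>j. z j t) - p l t) \<le> \<eta>"
    and p_bd: "\<And>l t. l \<in> I \<Longrightarrow> t \<in> {0..1} \<Longrightarrow> norm (p l t) \<le> P"
    and p': "\<And>l t. l \<in> I \<Longrightarrow> (p l has_vector_derivative p' l t) (at t)"
    and p'_bd: "\<And>l t. l \<in> I \<Longrightarrow> t \<in> {0..1} \<Longrightarrow> norm (p' l t) \<le> Q"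
    and y0: "\<And>l. l \<in> I \<Longrightarrow> y l 0 = z l 0" and y_cont: "\<And>l. l \<in> I \<Longrightarrow> continuous_on {0..1} (y l)"
    and y: "\<And>l t. l \<in> I \<Longrightarrow> t \<in> {0<..<1} - F \<Longrightarrow>
        (y l has_vector_derivative a l t *\<^sub>R v l (\<lambda>j. y j t)) (at t)"
    and A0: "\<And>l. l \<in> I \<Longrightarrow> A l 0 = 0" and A_cont: "\<And>l. l \<in> I \<Longrightarrow> continuous_on {0..1} (A l)"
    and A: "\<And>l t. l \<in> I \<Longrightarrow> t \<in> {0<..<1} - F \<Longrightarrow> (A l has_real_derivative a l t) (at t)"
    and a: "\<And>l t. l \<in> I \<Longrightarrow> t \<in> {0<..<1} - F \<Longrightarrow> 0 \<le> a l t"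
    and A_close: "\<And>l t. l \<in> I \<Longrightarrow> t \<in> {0..1} \<Longrightarrow> \<bar>A l t - t\<bar> \<le> \<epsilon>"
    and R: "R = ((L * \<epsilon> * P + \<eta>) * (2 * card I) + 2 * \<eta> + \<epsilon> * Q) * exp (2 * L * card I) + \<epsilon> * P"
    and small: "R \<le> \<delta>"
    and l: "l \<in> I" and t: "t \<in> {0..1}"
  shows "norm (y l t - z l t) \<le> R"
proof -
  define n where "n = real (card I)"
  \<comment> \<open>The sum of the clocks is the common Gronwall time: its rate b bounds every
    single rate, so one function u controls all components.\<close>
  define B where "B t = (\<Sum>j\<in>I. A j t)" for t
  define b where "b t = (\<Sum>j\<in>I. a j t)" for t
  define c where "c = L * \<epsilon> * P + \<eta>"
  \<comment> \<open>Exceeds the total forcing c * (2 * n) + \<eta> + \<epsilon> * Q by one more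
    \<eta>; this surplus makes the final inequality strict.\<close>
  define \<kappa> where "\<kappa> = c * (2 * n) + 2 * \<eta> + \<epsilon> * Q"
  define u where "u t = \<kappa> * exp (L * B t)" for t
  define w where "w l t = y l t - z l t - (A l t - t) *\<^sub>R p l t" for l t
  have "0 \<le> n" "0 \<le> c" using pos by (auto simp: n_def c_def)
  then have "0 \<le> c * (2 * n)" "0 \<le> \<epsilon> * Q" using pos by simp_all
  then have "0 < \<kappa>" using pos unfolding \<kappa>_def by linarith
  have z_cont: "continuous_on {0..1} (z l)" if "l \<in> I" for l
    by (rule continuous_on_vector_derivative) (rule z[OF that])
  have p_cont: "continuous_on {0..1} (p l)" if "l \<in> I" for l
    using p'[OF that] has_vector_derivative_at_within by (blast intro!: continuous_on_vector_derivative)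
  have w_cont: "continuous_on {0..1} (w l)" if "l \<in> I" for l
    unfolding w_def by (intro continuous_intros y_cont z_cont p_cont A_cont that)
  have B_cont: "continuous_on {0..1} B"
    unfolding B_def by (intro continuous_intros A_cont)
  have u_cont: "continuous_on {0..1} u"
    unfolding u_def by (intro continuous_intros B_cont)
  have B_bd: "B t \<le> 2 * n" if "t \<in> {0..1}" for t
  proof -
    have "A j t \<le> 2" if "j \<in> I" for j
      using A_close[OF that \<open>t \<in> {0..1}\<close>] \<open>t \<in> {0..1}\<close> pos by auto
    then have "B t \<le> of_nat (card I) * 2"
      unfolding B_def by (intro sum_bounded_above) auto
    then show ?thesis by (simp add: n_def)
  qed
  have u_bd: "u t + \<epsilon> * P \<le> R" if "t \<in> {0..1}" for t
  proof -
    have "u t \<le> \<kappa> * exp (L * (2 * n))"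
      unfolding u_def using \<open>0 < \<kappa>\<close> B_bd[OF that] pos by (auto intro!: mult_left_mono)
    then show ?thesis unfolding R by (simp add: \<kappa>_def c_def n_def algebra_simps)
  qed
  have err: "norm (y j s - z j s) \<le> norm (w j s) + \<epsilon> * P" if "j \<in> I" "s \<in> {0..1}" for j s
  proof -
    have "norm (y j s - z j s) \<le> norm (w j s) + norm ((A j s - s) *\<^sub>R p j s)"
      unfolding w_def by (metis norm_triangle_ineq diff_add_cancel)
    also have "norm ((A j s - s) *\<^sub>R p j s) \<le> \<epsilon> * P"
      using A_close[OF that] p_bd[OF that] pos by (auto intro!: mult_mono)
    finally show ?thesis by simp
  qed
  have "norm (w l t) < u t"
  proof (rule first_failure[OF I w_cont u_cont _ l t])
    fix l t
    assume l: "l \<in> I" and t: "t \<in> {0..1}"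
      and before: "\<And>j s. j \<in> I \<Longrightarrow> s \<in> {0..<t} \<Longrightarrow> norm (w j s) < u s"
    \<comment> \<open>Its derivative dominates that of w l: u is the Gronwall part, with derivative
      L * b * u, and the other terms integrate the forcing.\<close>
    define g where "g s = u s + c * B s + (\<eta> + \<epsilon> * Q) * s" for s
    define w' where "w' s = a l s *\<^sub>R v l (\<lambda>j. y j s) - v l (\<lambda>j. z j s)
        - ((A l s - s) *\<^sub>R p' l s + (a l s - 1) *\<^sub>R p l s)" for s
    define g' where "g' s = L * b s * u s + c * b s + (\<eta> + \<epsilon> * Q)" for s
    have sub: "{0..t} \<subseteq> {0..1}" using t by auto
    have "norm (w l t - w l 0) \<le> g t - g 0"
    proof (rule piecewise_derivative_bound[OF F])
      show "0 \<le> t" using t by simp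
      show "continuous_on {0..t} (w l)"
        using w_cont[OF l] sub by (rule continuous_on_subset)
      have "continuous_on {0..1} g"
        unfolding g_def by (intro continuous_intros u_cont B_cont)
      then show "continuous_on {0..t} g"
        using sub by (rule continuous_on_subset)
    next
      fix s assume s: "s \<in> {0<..<t} - F"
      then have s': "s \<in> {0<..<1} - F" "s \<in> {0..1}" "s \<in> {0..<t}" using t by auto
      have z's: "(z l has_vector_derivative v l (\<lambda>j. z j s)) (at s)"
        using z[OF l s'(2)] s'(1) by (simp add: at_within_Icc_at)
      have "((\<lambda>s. A l s - s) has_real_derivative a l s - 1) (at s)"
        by (auto intro!: derivative_eq_intros A[OF l s'(1)])
      then have "((\<lambda>s. (A l s - s) *\<^sub>R p l s) has_vector_derivative
          (A l s - s) *\<^sub>R p' l s + (a l s - 1) *\<^sub>R p l s) (at s)"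
        using p'[OF l] by (rule has_vector_derivative_scaleR)
      then show "(w l has_vector_derivative w' s) (at s)"
        unfolding w_def w'_def
        by (intro has_vector_derivative_diff y[OF l s'(1)] z's)
      have B': "(B has_real_derivative b s) (at s)"
        unfolding B_def b_def using A s'(1) by (intro DERIV_sum) auto
      show "(g has_real_derivative g' s) (at s)"
        unfolding g_def u_def g'_def by (auto intro!: derivative_eq_intros B' simp: algebra_simps)
      define r where "r = u s + \<epsilon> * P"
      have "norm (y j s - z j s) \<le> r" if "j \<in> I" for j
        using err[OF that s'(2)] before[OF that s'(3)] by (simp add: r_def)
      \<comment> \<open>The bootstrap closes here: r \<le> R \<le> \<delta> keeps y s in the tube
        where \<open>lip\<close> is available.\<close>
      then have lip_s: "norm (v l (\<lambda>j. y j s) - v l (\<lambda>j. z j s)) \<le> L * r"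
        using lip[OF l s'(2)] u_bd[OF s'(2)] small by (simp add: r_def)
      have al: "0 \<le> a l s" "a l s \<le> b s"
        using a s'(1) l I by (auto simp: b_def intro!: member_le_sum)
      \<comment> \<open>Regrouped so that a - 1, which is not small, meets only the \<eta>-small
        error of p, while p' carries the \<epsilon>-small factor A - s.\<close>
      have "w' s = a l s *\<^sub>R (v l (\<lambda>j. y j s) - v l (\<lambda>j. z j s))
          + (a l s - 1) *\<^sub>R (v l (\<lambda>j. z j s) - p l s) - (A l s - s) *\<^sub>R p' l s"
        unfolding w'_def by (simp add: algebra_simps)
      also have "norm \<dots> \<le> norm (a l s *\<^sub>R (v l (\<lambda>j. y j s) - v l (\<lambda>j. z j s)))
          + norm ((a l s - 1) *\<^sub>R (v l (\<lambda>j. z j s) - p l s)) + norm ((A l s - s) *\<^sub>R p' l s)"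
        by (rule norm_triangle_le_diff[OF add_right_mono[OF norm_triangle_ineq]])
      also have "\<dots> \<le> b s * (L * r) + (b s + 1) * \<eta> + \<epsilon> * Q"
        using al lip_s p[OF l s'(2)] A_close[OF l s'(2)] p'_bd[OF l s'(2)] pos
        by (auto simp: r_def intro!: add_mono mult_mono)
      also have "\<dots> = g' s"
        by (simp add: g'_def r_def c_def algebra_simps)
      finally show "norm (w' s) \<le> g' s" .
    qed
    moreover have "w l 0 = 0"
      using y0[OF l] A0[OF l] by (simp add: w_def)
    moreover have "g 0 = \<kappa>"
      using A0 by (simp add: g_def u_def B_def)
    moreover have "c * B t \<le> c * (2 * n)"
      using B_bd[OF t] \<open>0 \<le> c\<close> by (intro mult_left_mono)
    moreover have "(\<eta> + \<epsilon> * Q) * t \<le> (\<eta> + \<epsilon> * Q) * 1"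
      using t pos by (intro mult_left_mono) auto
    ultimately show "norm (w l t) < u t"
      using pos by (simp add: g_def \<kappa>_def)
  qed
  then show ?thesis
    using err[OF l t] u_bd[OF t] by simp
qed

text \<open>Only continuity of the velocity along the limit curve is needed: replacing it by a polynomial
  supplies the differentiable \<open>p l\<close> of the previous estimate.\<close>

lemma averaging_principle:
  fixes z :: "'i \<Rightarrow> real \<Rightarrow> 'a::euclidean_space" and v :: "'i \<Rightarrow> ('i \<Rightarrow> 'a) \<Rightarrow> 'a"
  assumes I: "finite I" and L: "0 \<le> L" and \<delta>: "0 < \<delta>" and e: "0 < e"
    and z: "\<And>l t. l \<in> I \<Longrightarrow> t \<in> {0..1} \<Longrightarrow> (z l has_vector_derivative v l (\<lambda>j. z j t)) (at t within {0..1})"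
    and v_cont: "\<And>l. l \<in> I \<Longrightarrow> continuous_on {0..1} (\<lambda>t. v l (\<lambda>j. z j t))"
    and lip: "\<And>l t r x. l \<in> I \<Longrightarrow> t \<in> {0..1} \<Longrightarrow> r \<le> \<delta> \<Longrightarrow> (\<And>j. j \<in> I \<Longrightarrow> norm (x j - z j t) \<le> r)
        \<Longrightarrow> norm (v l x - v l (\<lambda>j. z j t)) \<le> L * r"
  obtains \<epsilon> where "0 < \<epsilon>"
    and "\<And>F y A a l t. finite F \<Longrightarrow>
      (\<And>l. l \<in> I \<Longrightarrow> y l 0 = z l 0) \<Longrightarrow> (\<And>l. l \<in> I \<Longrightarrow> continuous_on {0..1} (y l)) \<Longrightarrow>
      (\<And>l t. l \<in> I \<Longrightarrow> t \<in> {0<..<1} - F \<Longrightarrow>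
        (y l has_vector_derivative a l t *\<^sub>R v l (\<lambda>j. y j t)) (at t)) \<Longrightarrow>
      (\<And>l. l \<in> I \<Longrightarrow> A l 0 = 0) \<Longrightarrow> (\<And>l. l \<in> I \<Longrightarrow> continuous_on {0..1} (A l)) \<Longrightarrow>
      (\<And>l t. l \<in> I \<Longrightarrow> t \<in> {0<..<1} - F \<Longrightarrow> (A l has_real_derivative a l t) (at t)) \<Longrightarrow>
      (\<And>l t. l \<in> I \<Longrightarrow> t \<in> {0<..<1} - F \<Longrightarrow> 0 \<le> a l t) \<Longrightarrow>
      (\<And>l t. l \<in> I \<Longrightarrow> t \<in> {0..1} \<Longrightarrow> \<bar>A l t - t\<bar> \<le> \<epsilon>) \<Longrightarrow>
      l \<in> I \<Longrightarrow> t \<in> {0..1} \<Longrightarrow> norm (y l t - z l t) \<le> e"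
proof -
  define n where "n = real (card I)"
  define D where "D = exp (2 * L * n)"
  \<comment> \<open>R must stay below e for the conclusion and below \<delta> for the tube.\<close>
  define e' where "e' = min e \<delta>"
  \<comment> \<open>Chosen so that R 0 = e' / 2. The order matters: \<eta> determines the
    polynomials, hence P and Q, and only then is \<epsilon> made small against them.\<close>
  define \<eta> where "\<eta> = e' / (2 * (2 * n + 2) * D)"
  have pos: "0 < e'" "0 < D" "0 \<le> n" using e \<delta> by (auto simp: e'_def D_def n_def)
  then have \<eta>: "0 < \<eta>" by (simp add: \<eta>_def)
  have "\<exists>p. \<forall>l\<in>I. polynomial_function (p l) \<and> (\<forall>t\<in>{0..1}. norm (v l (\<lambda>j. z j t) - p l t) < \<eta>)"
    using Stone_Weierstrass_polynomial_function[OF compact_Icc v_cont \<eta>] by (intro bchoice ballI) blast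
  then obtain p where poly: "\<And>l. l \<in> I \<Longrightarrow> polynomial_function (p l)"
    and p: "\<And>l t. l \<in> I \<Longrightarrow> t \<in> {0..1} \<Longrightarrow> norm (v l (\<lambda>j. z j t) - p l t) < \<eta>"
    by blast
  have "\<exists>p'. \<forall>l\<in>I. polynomial_function (p' l) \<and> (\<forall>t. (p l has_vector_derivative p' l t) (at t))"
    using has_vector_derivative_polynomial_function[OF poly] by (intro bchoice ballI) metis
  then obtain p' where poly': "\<And>l. l \<in> I \<Longrightarrow> polynomial_function (p' l)"
    and p': "\<And>l t. l \<in> I \<Longrightarrow> (p l has_vector_derivative p' l t) (at t)"
    by blast
  have bound: "\<exists>B\<ge>0. \<forall>l\<in>I. \<forall>t\<in>{0..1::real}. norm (q l t) \<le> B"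
    if "\<And>l. l \<in> I \<Longrightarrow> polynomial_function (q l)" for q :: "'i \<Rightarrow> real \<Rightarrow> 'a"
  proof -
    have "compact (\<Union>l\<in>I. q l ` {0..1})"
      using that I by (intro compact_UN compact_continuous_image continuous_on_polymonial_function) auto
    then obtain B where "\<forall>x\<in>(\<Union>l\<in>I. q l ` {0..1}). norm x \<le> B"
      using compact_imp_bounded bounded_iff by blast
    then have "norm (q l t) \<le> max B 0" if "l \<in> I" "t \<in> {0..1}" for l t
      using that by (meson UN_I image_eqI max.coboundedI1)
    then show ?thesis by (intro exI[of _ "max B 0"]) simp
  qed
  obtain P where P: "0 \<le> P" "\<And>l t. l \<in> I \<Longrightarrow> t \<in> {0..1} \<Longrightarrow> norm (p l t) \<le> P"
    using bound[of p] poly by blast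
  obtain Q where Q: "0 \<le> Q" "\<And>l t. l \<in> I \<Longrightarrow> t \<in> {0..1} \<Longrightarrow> norm (p' l t) \<le> Q"
    using bound[of p'] poly' by blast
  define R where "R \<epsilon> = ((L * \<epsilon> * P + \<eta>) * (2 * card I) + 2 * \<eta> + \<epsilon> * Q) * exp (2 * L * card I) + \<epsilon> * P" for \<epsilon>
  have "R 0 = \<eta> * (2 * n + 2) * D"
    by (simp add: R_def n_def D_def algebra_simps)
  also have "\<dots> = e' / 2"
  proof -
    have "(2 * n + 2) * D \<noteq> 0" using pos by simp
    moreover have "\<eta> = e' / 2 / ((2 * n + 2) * D)" by (simp add: \<eta>_def mult.assoc)
    ultimately have "\<eta> * ((2 * n + 2) * D) = e' / 2" by (rule nonzero_eq_divide_eq[THEN iffD1])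
    then show ?thesis by (simp only: mult.assoc)
  qed
  finally have "R 0 < e'" using pos by simp
  moreover have "(R \<longlongrightarrow> R 0) (at_right 0)"
    unfolding R_def by (intro tendsto_intros)
  ultimately have "\<forall>\<^sub>F \<epsilon> in at_right 0. R \<epsilon> < e'"
    by (rule order_tendstoD(2)[rotated])
  moreover have "\<forall>\<^sub>F \<epsilon> in at_right 0. (\<epsilon>::real) \<in> {0<..<1}"
    by (rule eventually_at_right_real) simp
  ultimately have "\<forall>\<^sub>F \<epsilon> in at_right 0. R \<epsilon> < e' \<and> \<epsilon> \<in> {0<..<1}"
    by (rule eventually_conj)
  then have "\<exists>\<epsilon>. R \<epsilon> < e' \<and> \<epsilon> \<in> {0<..<1}"
    by (rule eventually_happens'[rotated]) simp
  then obtain \<epsilon> where \<epsilon>: "R \<epsilon> < e'" "0 < \<epsilon>" "\<epsilon> < 1"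
    by auto
  show ?thesis
  proof (rule that[OF \<epsilon>(2)])
    fix F y A a l and t :: real
    assume *: "finite F" "\<And>l. l \<in> I \<Longrightarrow> y l 0 = z l 0" "\<And>l. l \<in> I \<Longrightarrow> continuous_on {0..1} (y l)"
      "\<And>l t. l \<in> I \<Longrightarrow> t \<in> {0<..<1} - F \<Longrightarrow>
        (y l has_vector_derivative a l t *\<^sub>R v l (\<lambda>j. y j t)) (at t)"
      "\<And>l. l \<in> I \<Longrightarrow> A l 0 = 0" "\<And>l. l \<in> I \<Longrightarrow> continuous_on {0..1} (A l)"
      "\<And>l t. l \<in> I \<Longrightarrow> t \<in> {0<..<1} - F \<Longrightarrow> (A l has_real_derivative a l t) (at t)"
      "\<And>l t. l \<in> I \<Longrightarrow> t \<in> {0<..<1} - F \<Longrightarrow> 0 \<le> a l t"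
      "\<And>l t. l \<in> I \<Longrightarrow> t \<in> {0..1} \<Longrightarrow> \<bar>A l t - t\<bar> \<le> \<epsilon>"
      "l \<in> I" "t \<in> {0..1}"
    have "R \<epsilon> \<le> \<delta>" using \<epsilon> by (simp add: e'_def)
    have "norm (y l t - z l t) \<le> R \<epsilon>"
      by (rule averaging_estimate[where I = I and F = F and L = L and \<eta> = \<eta> and \<epsilon> = \<epsilon> and P = P and Q = Q and R = "R \<epsilon>" and z = z
            and v = v and p = p and p' = p' and y = y and A = A and a = a
            and \<delta> = \<delta>, OF I *(1) L \<eta> less_imp_le[OF \<epsilon>(2)] less_imp_le[OF \<epsilon>(3)] P(1) Q(1)
            z lip less_imp_le[OF p] P(2) p' Q(2) *(2-9) R_def \<open>R \<epsilon> \<le> \<delta>\<close> *(10,11)])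
    then show "norm (y l t - z l t) \<le> e" using \<epsilon> by (simp add: e'_def)
  qed
qed

section \<open>Convergence of the interpolated flow\<close>

lemma (in prob_space) indep_vars_reindex:
  assumes f: "inj_on f I" and X: "indep_vars (\<lambda>_. N) X (f ` I)"
  shows "indep_vars (\<lambda>_. N) (\<lambda>i. X (f i)) I"
  unfolding indep_vars_def2
proof (intro conjI ballI)
  let ?E = "\<lambda>i. {X i -` A \<inter> space M |A. A \<in> sets N}"
  have rv: "\<And>i. i \<in> I \<Longrightarrow> random_variable N (X (f i))" and ind: "indep_sets ?E (f ` I)"
    using X by (auto simp: indep_vars_def2)
  then show "random_variable N (X (f i))" if "i \<in> I" for i
    using that by blast
  show "indep_sets (\<lambda>i. ?E (f i)) I"
  proof (rule indep_setsI)
    show "?E (f i) \<subseteq> events" if "i \<in> I" for i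
      using rv[OF that] by (auto intro: measurable_sets)
    fix A J assume J: "J \<noteq> {}" "J \<subseteq> I" "finite J" "\<forall>j\<in>J. A j \<in> ?E (f j)"
    \<comment> \<open>Independence over the image is indexed by values of f, so the events are
      carried along the inverse of f on J.\<close>
    define A' where "A' j = A (inv_into J f j)" for j
    have inj: "inj_on f J" using f J(2) inj_on_subset by blast
    have A': "A' (f j) = A j" if "j \<in> J" for j
      using that inj by (simp add: A'_def)
    have "prob (\<Inter>j\<in>f ` J. A' j) = (\<Prod>j\<in>f ` J. prob (A' j))"
      by (rule indep_setsD[OF ind]) (use J A' in \<open>auto simp: image_iff\<close>)
    also have "(\<Inter>j\<in>f ` J. A' j) = (\<Inter>j\<in>J. A j)"
      using A' by auto
    also have "(\<Prod>j\<in>f ` J. prob (A' j)) = (\<Prod>j\<in>J. prob (A j))"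
      using A' by (simp add: prod.reindex[OF inj])
    finally show "prob (\<Inter>j\<in>J. A j) = (\<Prod>j\<in>J. prob (A j))" .
  qed
qed

text \<open>Every block of N consecutive indices contains exactly one hit, of weight N. The
  deviation thus returns to its old value after a full block and stays within N inside one.\<close>

lemma sum_periodic_indicator:
  fixes l N k :: nat
  assumes l: "l \<in> {1..N}"
  shows "\<bar>(\<Sum>i<k. if i mod N + 1 = l then real N else 0) - real k\<bar> \<le> real N"
proof -
  define b where "b i = (if i mod N + 1 = l then real N else 0)" for i
  have b: "(\<Sum>i<k. b i) = (if l \<le> k then real N else 0)" if "k \<le> N" for k
  proof -
    have "(\<Sum>i<k. b i) = (\<Sum>i<k. if i = l - 1 then real N else 0)"
      using that l by (intro sum.cong) (auto simp: b_def)
    also have "\<dots> = (if l - 1 < k then real N else 0)"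
      by simp
    finally show ?thesis using l by (auto split: if_splits)
  qed
  have shift: "(\<Sum>i<N + j. b i) = real N + (\<Sum>i<j. b i)" for j
    using b[of N] l by (induction j) (auto simp: b_def)
  have "\<bar>(\<Sum>i<k. b i) - real k\<bar> \<le> real N"
  proof (induction k rule: less_induct)
    case (less k)
    show ?case
    proof (cases "k < N")
      case True
      then show ?thesis using b[of k] by auto
    next
      case False
      then have "k = N + (k - N)" "k - N < k" using l by auto
      then show ?thesis using less[of "k - N"] shift[of "k - N"] by (metis add_diff_cancel_left of_nat_add)
    qed
  qed
  then show ?thesis by (simp add: b_def)
qed

section \<open>Clocks on the uniform partition of the unit interval\<close>

lemma unit_interval_piece:
  assumes "0 < n" "t \<in> {0..1::real}"
  obtains k where "k < n" "t \<in> {real k / real n .. real (k + 1) / real n}"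
\<comment> \<open>At t = 1 the floor would give the index n, one past the last piece.\<close>
proof (cases "t = 1")
  case True
  have "real (n - 1) / real n \<le> 1" "real (n - 1 + 1) / real n = 1"
    using assms by auto
  then show ?thesis using that[of "n - 1"] True assms by auto
next
  case False
  define k where "k = nat \<lfloor>t * real n\<rfloor>"
  have "0 \<le> t * real n" "t * real n < real n"
    using assms False by auto
  then have "real k \<le> t * real n" "t * real n < real k + 1" "k < n"
    unfolding k_def by linarith+
  then show ?thesis
    using that[of k] assms by (auto simp: field_simps)
qed

lemma unit_interval_open_piece:
  assumes "0 < n" "t \<in> {0<..<1::real} - (\<lambda>k. real k / real n) ` {..n}"
  obtains k where "k < n" "t \<in> {real k / real n <..< real (k + 1) / real n}"
proof -
  obtain k where k: "k < n" "t \<in> {real k / real n .. real (k + 1) / real n}"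
    using unit_interval_piece[of n t] assms by auto
  moreover have "t \<noteq> real k / real n" "t \<noteq> real (k + 1) / real n"
    using assms(2) k(1) by (metis DiffD2 atMost_iff image_eqI less_imp_le, metis DiffD2 Suc_eq_plus1 Suc_leI atMost_iff image_eqI)
  ultimately show ?thesis using that by auto
qed

text \<open>At grid points the clock is a partial sum divided by n. In between it is monotone, as c
  k is non-negative, so it is squeezed by the bounds at k and k + 1; the extra 1 is the length of a
  piece in units of 1 / n.\<close>

lemma glue_clock_close:
  assumes n: "0 < n" and c: "\<And>k. 0 \<le> c k"
    and E: "\<And>k. k \<le> n \<Longrightarrow> \<bar>(\<Sum>i<k. c i) - real k\<bar> \<le> E" and t: "t \<in> {0..1}"
  shows "\<bar>glue (real n) n (\<lambda>k s. c k * s) t - t\<bar> \<le> (E + 1) / real n"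
proof -
  obtain k where k: "k < n" "t \<in> {real k / real n .. real (k + 1) / real n}"
    using unit_interval_piece[OF n t] by blast
  have "glue (real n) n (\<lambda>k s. c k * s) t =
      (\<Sum>i<k. c i * (real (i + 1) / real n) - c i * (real i / real n)) + (c k * t - c k * (real k / real n))"
    using glue_on_piece[of "real n" k n t "\<lambda>k s. c k * s"] n k by simp
  also have "(\<Sum>i<k. c i * (real (i + 1) / real n) - c i * (real i / real n)) = (\<Sum>i<k. c i) / real n"
    unfolding sum_divide_distrib by (intro sum.cong refl) (use n in \<open>simp add: field_simps\<close>)
  finally have "glue (real n) n (\<lambda>k s. c k * s) t * real n = (\<Sum>i<k. c i) + c k * (t * real n - real k)"
    using n by (simp add: field_simps)
  moreover have tn: "0 \<le> t * real n - real k" "t * real n - real k \<le> 1"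
    using k(2) n by (auto simp: field_simps)
  then have "0 \<le> c k * (t * real n - real k)" "c k * (t * real n - real k) \<le> c k * 1"
    using c by (auto intro!: mult_left_mono simp del: mult_1_right)
  moreover have "\<bar>(\<Sum>i<k. c i) - real k\<bar> \<le> E" "\<bar>(\<Sum>i<k. c i) + c k - (real k + 1)\<bar> \<le> E"
    using E[of k] E[of "Suc k"] k(1) by (simp_all add: algebra_simps)
  ultimately have "\<bar>glue (real n) n (\<lambda>k s. c k * s) t * real n - t * real n\<bar> \<le> E + 1"
    using tn by linarith
  then have "\<bar>glue (real n) n (\<lambda>k s. c k * s) t - t\<bar> * real n \<le> E + 1"
    by (simp add: abs_mult left_diff_distrib[symmetric])
  then show ?thesis using n by (simp add: pos_le_divide_eq)
qed

section \<open>Velocities and curves lifted to the plane\<close>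

lemma vortex_velocity_cong:
  assumes "\<And>j. j \<in> {1..N} \<Longrightarrow> x j = x' j" "l \<in> {1..N}"
  shows "vortex_velocity N \<xi> K l x = vortex_velocity N \<xi> K l x'"
  unfolding vortex_velocity_def using assms by (intro sum.cong) auto

text \<open>The velocity as a function of planar positions, in the form required by the averaging
  principle, which works in a Euclidean space.\<close>

definition lifted_velocity ::
  "nat \<Rightarrow> (nat \<Rightarrow> real) \<Rightarrow> (torus \<Rightarrow> real^2) \<Rightarrow> nat \<Rightarrow> (nat \<Rightarrow> real^2) \<Rightarrow> real^2"
  where "lifted_velocity N \<xi> K l x = vortex_velocity N \<xi> K l (\<lambda>j. tor (x j))"

text \<open>Over the compact time interval the pairwise differences trace a compact set that misses
  the lattice, and the kernel is Lipschitz near it.\<close>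

lemma vortex_velocity_near_curve:
  fixes \<xi> :: "nat \<Rightarrow> real" and z :: "nat \<Rightarrow> real \<Rightarrow> real^2"
  assumes G: "smooth_on (- {0}) G"
    and z: "\<And>l. l \<in> {1..N} \<Longrightarrow> continuous_on {0..1} (z l)"
    and apart: "\<And>l j t. l \<in> {1..N} \<Longrightarrow> j \<in> {1..N} \<Longrightarrow> l \<noteq> j \<Longrightarrow> t \<in> {0..1} \<Longrightarrow> tor (z l t) \<noteq> tor (z j t)"
  defines "v \<equiv> lifted_velocity N \<xi> (biot_savart G)"
  obtains L \<delta> where "0 \<le> L" "0 < \<delta>"
    and "\<And>l t r x. l \<in> {1..N} \<Longrightarrow> t \<in> {0..1} \<Longrightarrow> r \<le> \<delta> \<Longrightarrow>
      (\<And>j. j \<in> {1..N} \<Longrightarrow> norm (x j - z j t) \<le> r) \<Longrightarrow> norm (v l x - v l (\<lambda>j. z j t)) \<le> L * r"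
    and "\<And>l. l \<in> {1..N} \<Longrightarrow> continuous_on {0..1} (\<lambda>t. v l (\<lambda>j. z j t))"
proof -
  define k where "k y = biot_savart G (tor y)" for y
  have v: "v l x = (\<Sum>j\<in>{1..N} - {l}. \<xi> j *\<^sub>R k (x l - x j))" for l x
    by (simp add: v_def lifted_velocity_def vortex_velocity_def k_def tor_diff)
  have U: "z l t - z j t \<in> {y. tor y \<noteq> 0}"
    if "l \<in> {1..N}" "j \<in> {1..N} - {l}" "t \<in> {0..1}" for l j t
    using apart[of l j t] that by (auto simp: tor_diff)
  define C where "C = (\<Union>l\<in>{1..N}. \<Union>j\<in>{1..N} - {l}. (\<lambda>t. z l t - z j t) ` {0..1})"
  have "compact C"
    unfolding C_def
    by (intro compact_UN compact_continuous_image continuous_intros z finite_Diff finite_atLeastAtMost compact_Icc) auto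
  moreover have "C \<subseteq> {y. tor y \<noteq> 0}"
    unfolding C_def using U by blast
  ultimately obtain L \<delta> where L: "0 \<le> L" "0 < \<delta>"
    and lip: "\<And>p q. p \<in> C \<Longrightarrow> norm (q - p) \<le> \<delta> \<Longrightarrow> norm (k q - k p) \<le> L * norm (q - p)"
    using biot_savart_Lipschitz_near_compact[OF G] unfolding k_def by metis
  show ?thesis
  \<comment> \<open>Moving two vortices by r moves their difference by up to 2 * r; hence the factor
    2 and the radius \<delta> / 2.\<close>
  proof (rule that[of "(\<Sum>j\<in>{1..N}. \<bar>\<xi> j\<bar>) * (L * 2)" "\<delta> / 2"])
    show "0 \<le> (\<Sum>j\<in>{1..N}. \<bar>\<xi> j\<bar>) * (L * 2)" "0 < \<delta> / 2"
      using L by (auto intro!: mult_nonneg_nonneg sum_nonneg)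
  next
    fix l t r x
    assume l: "l \<in> {1..N}" and t: "t \<in> {0..1}" and r: "r \<le> \<delta> / 2"
      and x: "\<And>j. j \<in> {1..N} \<Longrightarrow> norm (x j - z j t) \<le> r"
    have "0 \<le> r" using x[OF l] norm_ge_zero order_trans by blast
    have pair: "norm (k (x l - x j) - k (z l t - z j t)) \<le> L * (2 * r)" if j: "j \<in> {1..N} - {l}" for j
    proof -
      have "(x l - x j) - (z l t - z j t) = (x l - z l t) - (x j - z j t)" by simp
      then have "norm ((x l - x j) - (z l t - z j t)) \<le> norm (x l - z l t) + norm (x j - z j t)"
        by (metis norm_triangle_ineq4)
      then have d: "norm ((x l - x j) - (z l t - z j t)) \<le> 2 * r"
        using x[OF l] x[of j] j by auto
      have "z l t - z j t \<in> C" unfolding C_def using l j t by blast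
      then have "norm (k (x l - x j) - k (z l t - z j t)) \<le> L * norm ((x l - x j) - (z l t - z j t))"
        using d r by (intro lip) auto
      also have "\<dots> \<le> L * (2 * r)" using d L by (intro mult_left_mono)
      finally show ?thesis .
    qed
    have "v l x - v l (\<lambda>j. z j t) = (\<Sum>j\<in>{1..N} - {l}. \<xi> j *\<^sub>R (k (x l - x j) - k (z l t - z j t)))"
      by (simp add: v sum_subtractf scaleR_diff_right)
    also have "norm \<dots> \<le> (\<Sum>j\<in>{1..N} - {l}. \<bar>\<xi> j\<bar> * (L * (2 * r)))"
      by (rule sum_norm_le) (auto intro!: mult_left_mono pair)
    \<comment> \<open>The term j = l is added to obtain a constant independent of l.\<close>
    also have "\<dots> \<le> (\<Sum>j\<in>{1..N}. \<bar>\<xi> j\<bar> * (L * (2 * r)))"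
      using L \<open>0 \<le> r\<close> by (intro sum_mono2) auto
    also have "\<dots> = (\<Sum>j\<in>{1..N}. \<bar>\<xi> j\<bar>) * (L * 2) * r"
      by (simp add: sum_distrib_right mult.assoc)
    finally show "norm (v l x - v l (\<lambda>j. z j t)) \<le> (\<Sum>j\<in>{1..N}. \<bar>\<xi> j\<bar>) * (L * 2) * r" .
  next
    fix l assume l: "l \<in> {1..N}"
    have "continuous_on {0..1} (\<lambda>t. k (z l t - z j t))" if j: "j \<in> {1..N} - {l}" for j
      unfolding k_def
      by (rule continuous_on_compose2[OF continuous_on_biot_savart[OF G]])
         (use l j U[OF l j] in \<open>auto intro!: continuous_intros z\<close>)
    then show "continuous_on {0..1} (\<lambda>t. v l (\<lambda>j. z j t))"
      unfolding v by (intro continuous_intros) auto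
  qed
qed

text \<open>Each piece comes with its own lift, and neighbouring lifts may differ by a lattice
  vector at the joint. Gluing increments removes these jumps, and y0 fixes the lift that starts
  where the lift of the limit curve does.\<close>

lemma interpolated_solution_lift:
  assumes sol: "interpolated_solution N \<xi> K \<tau> m x \<psi>" and pos: "1 \<le> N" "1 \<le> m"
    and l: "l \<in> {1..N}" and y0: "tor y0 = x l"
  obtains Y where "Y 0 = y0" "continuous_on {0..1} Y" "\<And>t. t \<in> {0..1} \<Longrightarrow> tor (Y t) = \<psi> t l"
    and "\<And>k t. k < N * m \<Longrightarrow> t \<in> {real k / real (N * m) <..< real (k + 1) / real (N * m)} \<Longrightarrow>
      (Y has_vector_derivative (real N * \<tau> (k + 1)) *\<^sub>R single_field N \<xi> K (k mod N + 1) (\<psi> t) l) (at t)"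
proof -
  define H where "H = real (N * m)"
  have H: "0 < H" using pos by (simp add: H_def)
  let ?I = "\<lambda>k. {real k / H .. real (k + 1) / H}"
  have "\<forall>k. \<exists>y. \<forall>t\<in>?I k. \<psi> t l = tor (y t) \<and>
      (y has_vector_derivative (real N * \<tau> (k + 1)) *\<^sub>R single_field N \<xi> K (k mod N + 1) (\<psi> t) l) (at t within ?I k)"
    using sol l by (auto simp: interpolated_solution_def has_velocity_on_def H_def)
  then obtain f where f: "\<And>k t. t \<in> ?I k \<Longrightarrow> \<psi> t l = tor (f k t)"
    and f': "\<And>k t. t \<in> ?I k \<Longrightarrow> (f k has_vector_derivative
        (real N * \<tau> (k + 1)) *\<^sub>R single_field N \<xi> K (k mod N + 1) (\<psi> t) l) (at t within ?I k)"
    by metis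
  have ends: "real k / H \<in> ?I k" "real (k + 1) / H \<in> ?I k" for k
    using H by (auto simp: divide_right_mono)
  have f_cont: "continuous_on (?I k) (f k)" for k
    by (rule continuous_on_vector_derivative) (rule f')
  \<comment> \<open>\<open>tor\<close> is additive, so planar increments project to increments of
    \<psi>, and these telescope.\<close>
  have partial_sums: "tor (y0 + (\<Sum>i<k. f i (real (i + 1) / H) - f i (real i / H))) = \<psi> (real k / H) l" for k
  proof (induction k)
    case 0
    then show ?case using y0 sol by (simp add: interpolated_solution_def)
  next
    case (Suc k)
    have "tor (y0 + (\<Sum>i<Suc k. f i (real (i + 1) / H) - f i (real i / H))) =
        tor (y0 + (\<Sum>i<k. f i (real (i + 1) / H) - f i (real i / H)))
        + (tor (f k (real (k + 1) / H)) - tor (f k (real k / H)))"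
      by (simp only: sum.lessThan_Suc tor_add tor_diff add.assoc)
    also have "\<dots> = \<psi> (real k / H) l + (\<psi> (real (k + 1) / H) l - \<psi> (real k / H) l)"
      by (simp only: Suc.IH f[OF ends(1), symmetric] f[OF ends(2), symmetric])
    finally show ?case by simp
  qed
  show ?thesis
  proof (rule that[of "\<lambda>t. y0 + glue H (N * m) f t"])
    show "y0 + glue H (N * m) f 0 = y0"
      using glue_on_piece[OF H, of 0 "N * m" 0 f] pos H by simp
    show "continuous_on {0..1} (\<lambda>t. y0 + glue H (N * m) f t)"
      by (intro continuous_intros continuous_on_glue H f_cont)
    show "tor (y0 + glue H (N * m) f t) = \<psi> t l" if "t \<in> {0..1}" for t
    proof -
      have "0 < N * m" using pos by simp
      from unit_interval_piece[OF this that] obtain k where k: "k < N * m" "t \<in> ?I k"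
        unfolding H_def by blast
      have "tor (y0 + glue H (N * m) f t) =
          tor (y0 + (\<Sum>i<k. f i (real (i + 1) / H) - f i (real i / H))) + (tor (f k t) - tor (f k (real k / H)))"
        by (simp only: glue_on_piece[OF H k] tor_add tor_diff add.assoc)
      also have "\<dots> = \<psi> (real k / H) l + (\<psi> t l - \<psi> (real k / H) l)"
        by (simp only: partial_sums f[OF ends(1), symmetric] f[OF k(2), symmetric])
      finally show ?thesis by simp
    qed
    fix k t assume k: "k < N * m" and "t \<in> {real k / real (N * m) <..< real (k + 1) / real (N * m)}"
    then have t: "t \<in> {real k / H <..< real (k + 1) / H}" by (simp only: H_def)
    then have "t \<in> ?I k" by auto
    from has_vector_derivative_glue[where f = f, OF H k t f'[OF this]]
    show "((\<lambda>t. y0 + glue H (N * m) f t) has_vector_derivative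
        (real N * \<tau> (k + 1)) *\<^sub>R single_field N \<xi> K (k mod N + 1) (\<psi> t) l) (at t)"
      by (auto intro!: derivative_eq_intros)
  qed
qed

text \<open>The deterministic core: randomness has been reduced to the sign of \<tau> and the growth
  bound \<open>law\<close> for each residue class.\<close>

lemma pathwise_convergence:
  fixes \<xi> :: "nat \<Rightarrow> real"
  assumes N: "1 \<le> N" and G: "smooth_on (- {0}) G"
    and \<tau>: "\<And>i. 1 \<le> i \<Longrightarrow> 0 \<le> \<tau> i"
    and law: "\<And>l e. l \<in> {1..N} \<Longrightarrow> 0 < e \<Longrightarrow>
      \<exists>C. \<forall>k. \<bar>\<Sum>i<k. (if i mod N + 1 = l then real N else 0) * (\<tau> (i + 1) - 1)\<bar> \<le> e * real k + C"
    and \<phi>: "vortex_solution N \<xi> (biot_savart G) x \<phi>"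
    and \<psi>: "\<And>m. 1 \<le> m \<Longrightarrow> interpolated_solution N \<xi> (biot_savart G) \<tau> m x (\<psi> m)"
    and t: "t \<in> {0..1}" and l: "l \<in> {1..N}"
  shows "(\<lambda>m. \<psi> m t l) \<longlonglongrightarrow> \<phi> t l"
proof -
  define K where "K = biot_savart G"
  define v where "v = lifted_velocity N \<xi> K"
  have "\<forall>l\<in>{1..N}. \<exists>y. \<forall>t\<in>{0..}. \<phi> t l = tor (y t) \<and>
      (y has_vector_derivative vortex_velocity N \<xi> K l (\<phi> t)) (at t within {0..})"
    using \<phi> by (simp add: vortex_solution_def has_velocity_on_def K_def)
  from bchoice[OF this] obtain z where z0: "\<forall>l\<in>{1..N}. \<forall>t\<in>{0..}. \<phi> t l = tor (z l t) \<and>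
      (z l has_vector_derivative vortex_velocity N \<xi> K l (\<phi> t)) (at t within {0..})"
    by blast
  then have z_lift: "\<phi> t l = tor (z l t)" if "l \<in> {1..N}" "t \<in> {0..1}" for l t
    using that by simp
  have z: "(z l has_vector_derivative v l (\<lambda>j. z j t)) (at t within {0..1})"
    if "l \<in> {1..N}" "t \<in> {0..1}" for l t
  proof -
    have "(z l has_vector_derivative vortex_velocity N \<xi> K l (\<phi> t)) (at t within {0..})"
      using z0 that by simp
    then have "(z l has_vector_derivative vortex_velocity N \<xi> K l (\<phi> t)) (at t within {0..1})"
      by (rule has_vector_derivative_within_subset) auto
    moreover have "vortex_velocity N \<xi> K l (\<phi> t) = v l (\<lambda>j. z j t)"
      unfolding v_def lifted_velocity_def using that by (intro vortex_velocity_cong z_lift)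
    ultimately show ?thesis by simp
  qed
  have z_cont: "continuous_on {0..1} (z l)" if "l \<in> {1..N}" for l
    by (rule continuous_on_vector_derivative) (rule z[OF that])
  have z_start: "tor (z l 0) = x l" if "l \<in> {1..N}" for l
    using z_lift[OF that, of 0] \<phi> by (simp add: vortex_solution_def)
  have apart: "tor (z l t) \<noteq> tor (z j t)"
    if "l \<in> {1..N}" "j \<in> {1..N}" "l \<noteq> j" "t \<in> {0..1}" for l j t
  proof -
    have "\<phi> t \<in> configs N"
      using \<phi> that by (simp add: vortex_solution_def)
    then have "\<phi> t l \<noteq> \<phi> t j"
      using that by (simp add: configs_def)
    then show ?thesis using z_lift that by metis
  qed
  have close: "\<forall>\<^sub>F m in sequentially. \<exists>y. tor y = \<psi> m t l \<and> norm (y - z l t) \<le> e" if e: "0 < e" for e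
  proof (rule vortex_velocity_near_curve[where N = N and z = z and \<xi> = \<xi>, OF G z_cont apart,
        folded K_def, folded v_def])
    fix L \<delta> :: real
    assume L: "0 \<le> L" "0 < \<delta>"
      and lip: "\<And>l t r x. l \<in> {1..N} \<Longrightarrow> t \<in> {0..1} \<Longrightarrow> r \<le> \<delta> \<Longrightarrow>
        (\<And>j. j \<in> {1..N} \<Longrightarrow> norm (x j - z j t) \<le> r) \<Longrightarrow> norm (v l x - v l (\<lambda>j. z j t)) \<le> L * r"
      and v_cont: "\<And>l. l \<in> {1..N} \<Longrightarrow> continuous_on {0..1} (\<lambda>t. v l (\<lambda>j. z j t))"
    show ?thesis
    proof (rule averaging_principle[where z = z and v = v and e = e and L = L and \<delta> = \<delta>,
          OF finite_atLeastAtMost L e z v_cont lip])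
      fix \<epsilon> :: real
      assume \<epsilon>: "0 < \<epsilon>"
        and avg: "\<And>F y A a l t. finite F \<Longrightarrow>
          (\<And>l. l \<in> {1..N} \<Longrightarrow> y l 0 = z l 0) \<Longrightarrow> (\<And>l. l \<in> {1..N} \<Longrightarrow> continuous_on {0..1} (y l)) \<Longrightarrow>
          (\<And>l t. l \<in> {1..N} \<Longrightarrow> t \<in> {0<..<1} - F \<Longrightarrow>
            (y l has_vector_derivative a l t *\<^sub>R v l (\<lambda>j. y j t)) (at t)) \<Longrightarrow>
          (\<And>l. l \<in> {1..N} \<Longrightarrow> A l 0 = 0) \<Longrightarrow> (\<And>l. l \<in> {1..N} \<Longrightarrow> continuous_on {0..1} (A l)) \<Longrightarrow>
          (\<And>l t. l \<in> {1..N} \<Longrightarrow> t \<in> {0<..<1} - F \<Longrightarrow> (A l has_real_derivative a l t) (at t)) \<Longrightarrow>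
          (\<And>l t. l \<in> {1..N} \<Longrightarrow> t \<in> {0<..<1} - F \<Longrightarrow> 0 \<le> a l t) \<Longrightarrow>
          (\<And>l t. l \<in> {1..N} \<Longrightarrow> t \<in> {0..1} \<Longrightarrow> \<bar>A l t - t\<bar> \<le> \<epsilon>) \<Longrightarrow>
          l \<in> {1..N} \<Longrightarrow> t \<in> {0..1} \<Longrightarrow> norm (y l t - z l t) \<le> e"
      \<comment> \<open>The rate of the clock of vortex l on piece i, which uses \<tau> (i + 1) and
        moves vortex i mod N + 1.\<close>
      define c where "c l i = (if i mod N + 1 = l then real N else 0) * \<tau> (i + 1)" for l i
      have "\<forall>l\<in>{1..N}. \<exists>C. \<forall>k. \<bar>\<Sum>i<k. (if i mod N + 1 = l then real N else 0) * (\<tau> (i + 1) - 1)\<bar>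
          \<le> \<epsilon> / 2 * real k + C"
        by (intro ballI law) (use \<epsilon> in simp_all)
      from bchoice[OF this] obtain C where C: "\<And>l k. l \<in> {1..N} \<Longrightarrow>
          \<bar>\<Sum>i<k. (if i mod N + 1 = l then real N else 0) * (\<tau> (i + 1) - 1)\<bar> \<le> \<epsilon> / 2 * real k + C l"
        by blast
      define C' where "C' = (\<Sum>l\<in>{1..N}. \<bar>C l\<bar>)"
      have C': "C l \<le> C'" if "l \<in> {1..N}" for l
        using member_le_sum[of l "{1..N}" "\<lambda>l. \<bar>C l\<bar>"] that by (auto simp: C'_def)
      have c_sum: "\<bar>(\<Sum>i<k. c l i) - real k\<bar> \<le> \<epsilon> / 2 * real n + C' + real N"
        if lN: "l \<in> {1..N}" and "k \<le> n" for l k n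
      proof -
        have "(\<Sum>i<k. c l i) = (\<Sum>i<k. (if i mod N + 1 = l then real N else 0) * (\<tau> (i + 1) - 1))
            + (\<Sum>i<k. if i mod N + 1 = l then real N else 0)"
          unfolding sum.distrib[symmetric] by (intro sum.cong) (auto simp: c_def algebra_simps)
        moreover have "\<epsilon> / 2 * real k \<le> \<epsilon> / 2 * real n"
          using \<open>k \<le> n\<close> \<epsilon> by (intro mult_left_mono) auto
        ultimately show ?thesis
          using C[OF lN, of k] C'[OF lN] sum_periodic_indicator[OF lN, of k] by linarith
      qed
      have "(\<lambda>m. (\<epsilon> / 2 * real (N * m) + C' + real N + 1) / real (N * m)) \<longlonglongrightarrow> \<epsilon> / 2"
        using N by real_asymp
      then have "\<forall>\<^sub>F m in sequentially. (\<epsilon> / 2 * real (N * m) + C' + real N + 1) / real (N * m) < \<epsilon>"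
        by (rule order_tendstoD(2)) (use \<epsilon> in simp)
      then show ?thesis
        using eventually_ge_at_top[of 1]
      proof eventually_elim
        case (elim m)
        define n where "n = N * m"
        define F where "F = (\<lambda>k. real k / real n) ` {..n}"
        have n: "0 < n" using N elim by (simp add: n_def)
        have "\<forall>l\<in>{1..N}. \<exists>Y. Y 0 = z l 0 \<and> continuous_on {0..1} Y \<and> (\<forall>t\<in>{0..1}. tor (Y t) = \<psi> m t l) \<and>
            (\<forall>k t. k < n \<longrightarrow> t \<in> {real k / real n <..< real (k + 1) / real n} \<longrightarrow>
              (Y has_vector_derivative (real N * \<tau> (k + 1)) *\<^sub>R single_field N \<xi> K (k mod N + 1) (\<psi> m t) l) (at t))"
          using interpolated_solution_lift[OF \<psi>[OF elim(2)] N elim(2) _ z_start] unfolding K_def n_def by metis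
        from bchoice[OF this] obtain y where y: "\<forall>l\<in>{1..N}. y l 0 = z l 0 \<and> continuous_on {0..1} (y l) \<and>
            (\<forall>t\<in>{0..1}. tor (y l t) = \<psi> m t l) \<and>
            (\<forall>k t. k < n \<longrightarrow> t \<in> {real k / real n <..< real (k + 1) / real n} \<longrightarrow>
              (y l has_vector_derivative (real N * \<tau> (k + 1)) *\<^sub>R single_field N \<xi> K (k mod N + 1) (\<psi> m t) l) (at t))"
          by blast
        define A where "A l = glue (real n) n (\<lambda>k s. c l k * s)" for l
        \<comment> \<open>Off the open pieces the choice of k is arbitrary, yet the value is still
          non-negative because every c l k is.\<close>
        define a where "a l s = c l (SOME k. k < n \<and> s \<in> {real k / real n <..< real (k + 1) / real n})" for l s
        have a: "\<exists>k<n. s \<in> {real k / real n <..< real (k + 1) / real n} \<and> (\<forall>l. a l s = c l k)"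
          if "s \<in> {0<..<1} - F" for s
          using unit_interval_open_piece[OF n, of s] that unfolding F_def a_def by (metis (mono_tags, lifting) someI_ex)
        have y_der: "(y l has_vector_derivative a l s *\<^sub>R v l (\<lambda>j. y j s)) (at s)"
          if lN: "l \<in> {1..N}" and s: "s \<in> {0<..<1} - F" for l s
        proof -
          obtain k where k: "k < n" "s \<in> {real k / real n <..< real (k + 1) / real n}" "\<And>l. a l s = c l k"
            using a[OF s] by blast
          have "vortex_velocity N \<xi> K l (\<psi> m s) = v l (\<lambda>j. y j s)"
            unfolding v_def lifted_velocity_def using y s lN by (intro vortex_velocity_cong) auto
          then have "(real N * \<tau> (k + 1)) *\<^sub>R single_field N \<xi> K (k mod N + 1) (\<psi> m s) l = a l s *\<^sub>R v l (\<lambda>j. y j s)"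
            by (auto simp: k(3) c_def single_field_def)
          moreover have "(y l has_vector_derivative
              (real N * \<tau> (k + 1)) *\<^sub>R single_field N \<xi> K (k mod N + 1) (\<psi> m s) l) (at s)"
            using y lN k(1,2) by blast
          ultimately show ?thesis by simp
        qed
        have A_der: "(A l has_real_derivative a l s) (at s)" if s: "s \<in> {0<..<1} - F" for l s
        proof -
          obtain k where k: "k < n" "s \<in> {real k / real n <..< real (k + 1) / real n}" "\<And>l. a l s = c l k"
            using a[OF s] by blast
          have "((\<lambda>s. c l k * s) has_vector_derivative c l k) (at s within {real k / real n .. real (k + 1) / real n})"
            by (auto intro!: derivative_eq_intros simp: has_real_derivative_iff_has_vector_derivative[symmetric])
          from has_vector_derivative_glue[where f = "\<lambda>k s. c l k * s", OF _ k(1,2) this] n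
          show ?thesis
            by (simp add: A_def k(3) has_real_derivative_iff_has_vector_derivative)
        qed
        have c_nonneg: "0 \<le> c l k" for l k
          using \<tau> by (simp add: c_def)
        have "norm (y l t - z l t) \<le> e"
        proof (rule avg[where F = F and y = y and A = A and a = a])
          show "finite F" by (simp add: F_def)
          show "y l 0 = z l 0" "continuous_on {0..1} (y l)" if "l \<in> {1..N}" for l
            using y that by auto
          show "A l 0 = 0" for l
            using glue_on_piece[of "real n" 0 n 0 "\<lambda>k s. c l k * s"] n by (simp add: A_def)
          show "continuous_on {0..1} (A l)" for l
            unfolding A_def using n by (intro continuous_on_glue continuous_intros) auto
          show "0 \<le> a l s" for l s
            unfolding a_def by (rule c_nonneg)
          show "\<bar>A l s - s\<bar> \<le> \<epsilon>" if "l \<in> {1..N}" "s \<in> {0..1}" for l s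
          proof -
            have "\<bar>A l s - s\<bar> \<le> (\<epsilon> / 2 * real n + C' + real N + 1) / real n"
              unfolding A_def by (rule glue_clock_close[OF n c_nonneg c_sum[OF that(1)] that(2)])
            then show ?thesis using elim(1) unfolding n_def by linarith
          qed
          show "(A l has_real_derivative a l s) (at s)" if "s \<in> {0<..<1} - F" for l s
            using that by (rule A_der)
        qed (fact y_der t l)+
        then show ?case using y l t by blast
      qed
    qed
  qed
  show ?thesis
  \<comment> \<open>In the quotient topology a neighbourhood pulls back to an open set around the
    lift, so closeness of lifts suffices.\<close>
  proof (rule topological_tendstoI)
    fix S assume S: "open S" "\<phi> t l \<in> S"
    then have "open (tor -` S)" "z l t \<in> tor -` S"
      using z_lift[OF l t] by (simp_all add: open_torus_def)
    then obtain e where e: "0 < e" "cball (z l t) e \<subseteq> tor -` S"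
      using open_contains_cball by blast
    from close[OF e(1)] show "\<forall>\<^sub>F m in sequentially. \<psi> m t l \<in> S"
    proof eventually_elim
      case (elim m)
      then obtain y where y: "tor y = \<psi> m t l" "norm (y - z l t) \<le> e" by blast
      then have "y \<in> cball (z l t) e" by (simp add: dist_norm norm_minus_commute)
      then show ?case using e(2) y(1) by auto
    qed
  qed
qed

text \<open>The existence of a trajectory concerns x alone and the law of large numbers \<omega>
  alone. Two null rectangles cover the exceptional set, which settles the product without asking
  whether the convergence set is measurable.\<close>

lemma AE_pair_measure_conj:
  assumes "sigma_finite_measure M2" and P: "AE x in M1. P x" and Q: "AE y in M2. Q y"
  shows "AE (x, y) in M1 \<Otimes>\<^sub>M M2. P x \<and> Q y"
proof -
  interpret M2: sigma_finite_measure M2 by fact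
  obtain N1 where N1: "{x \<in> space M1. \<not> P x} \<subseteq> N1" "emeasure M1 N1 = 0" "N1 \<in> sets M1"
    using P by (rule AE_E)
  obtain N2 where N2: "{y \<in> space M2. \<not> Q y} \<subseteq> N2" "emeasure M2 N2 = 0" "N2 \<in> sets M2"
    using Q by (rule AE_E)
  have "N1 \<times> space M2 \<in> null_sets (M1 \<Otimes>\<^sub>M M2)" "space M1 \<times> N2 \<in> null_sets (M1 \<Otimes>\<^sub>M M2)"
    using N1 N2 by (auto simp: null_sets_def M2.emeasure_pair_measure_Times)
  then have "N1 \<times> space M2 \<union> space M1 \<times> N2 \<in> null_sets (M1 \<Otimes>\<^sub>M M2)"
    by (rule null_sets.Un)
  then show ?thesis
    by (rule AE_I') (use N1(1) N2(1) in \<open>auto simp: space_pair_measure\<close>)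
qed

text \<open>The tail bound is given for \<tau> 1; the common law \<rho> carries its second moment to
  all indices, with the integral of s^2 as uniform bound.\<close>

lemma (in prob_space) iid_residue_class_law:
  fixes \<tau> :: "nat \<Rightarrow> 'a \<Rightarrow> real"
  assumes indep: "indep_vars (\<lambda>_. borel) \<tau> {1..}"
    and nonneg: "\<And>i. 1 \<le> i \<Longrightarrow> AE \<omega> in M. 0 \<le> \<tau> i \<omega>"
    and law: "\<And>i. 1 \<le> i \<Longrightarrow> distr M borel (\<tau> i) = \<rho>"
    and mean: "\<And>i. 1 \<le> i \<Longrightarrow> expectation (\<tau> i) = 1"
    and tails: "exponential_tails (\<tau> 1)"
  shows "AE \<omega> in M. \<forall>e>0. \<exists>C. \<forall>k.
    \<bar>\<Sum>i<k. (if i mod N + 1 = l then real N else 0) * (\<tau> (i + 1) \<omega> - 1)\<bar> \<le> e * real k + C"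
proof (rule weighted_strong_law)
  have rv [measurable]: "random_variable borel (\<tau> (i + 1))" for i
    using indep by (simp add: indep_vars_def)
  have "range (\<lambda>i. i + 1) = {1::nat..}"
    by (auto simp: image_iff) (metis Suc_le_D Suc_eq_plus1)
  then show "indep_vars (\<lambda>_. borel) (\<lambda>i. \<tau> (i + 1)) UNIV"
    using indep by (intro indep_vars_reindex[of "\<lambda>i. i + 1"]) auto
  have int1: "integrable M (\<lambda>\<omega>. (\<tau> 1 \<omega>)\<^sup>2)"
    using rv[of 0] nonneg[of 1] tails by (intro exponential_tails_integrable_square) auto
  have \<rho>_int: "integrable \<rho> (\<lambda>s. s\<^sup>2)"
    using int1 rv[of 0] law[of 1] by (subst law[of 1, symmetric]) (auto simp: integrable_distr_eq)
  have distr: "\<rho> = distr M borel (\<tau> (i + 1))" for i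
    using law[of "i + 1"] by simp
  show "integrable M (\<lambda>\<omega>. (\<tau> (i + 1) \<omega>)\<^sup>2)" for i
    using \<rho>_int unfolding distr[of i] using integrable_distr_eq[OF rv, of "\<lambda>s. s\<^sup>2" i] by simp
  show "expectation (\<lambda>\<omega>. (\<tau> (i + 1) \<omega>)\<^sup>2) \<le> (\<integral>s. s\<^sup>2 \<partial>\<rho>)" for i
    unfolding distr[of i] using integral_distr[OF rv, of "\<lambda>s. s\<^sup>2" i] by simp
  show "AE \<omega> in M. 0 \<le> \<tau> (i + 1) \<omega>" "expectation (\<tau> (i + 1)) = 1" for i
    using nonneg mean by simp_all
  show "0 \<le> (if i mod N + 1 = l then real N else 0)" "(if i mod N + 1 = l then real N else 0) \<le> real N" for i
    by simp_all
qed

theorem theorem2p4: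
  fixes N :: nat and \<xi> :: "nat \<Rightarrow> real" and G :: "torus \<Rightarrow> real"
    and M :: "'w measure" and \<tau> :: "nat \<Rightarrow> 'w \<Rightarrow> real" and \<rho> :: "real measure"
    and \<Phi> :: "real \<Rightarrow> (nat \<Rightarrow> torus) \<Rightarrow> (nat \<Rightarrow> torus)"
    and \<Psi> :: "nat \<Rightarrow> 'w \<Rightarrow> real \<Rightarrow> (nat \<Rightarrow> torus) \<Rightarrow> (nat \<Rightarrow> torus)"
  assumes N: "N \<ge> 1"
    and \<xi>: "\<And>i. i \<in> {1..N} \<Longrightarrow> \<xi> i \<noteq> 0"
    and G: "green_function G"
    and M: "prob_space M"
    and nonneg: "\<And>i. i \<ge> 1 \<Longrightarrow> AE \<omega> in M. 0 \<le> \<tau> i \<omega>"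
    and indep: "prob_space.indep_vars M (\<lambda>_. borel) \<tau> {1..}"
    and law: "\<And>i. i \<ge> 1 \<Longrightarrow> distr M borel (\<tau> i) = \<rho>"
    and tails: "prob_space.exponential_tails M (\<tau> 1)"
    and mean: "\<And>i. i \<ge> 1 \<Longrightarrow> prob_space.expectation M (\<tau> i) = 1"
    and \<Phi>: "vortex_flow N \<xi> (biot_savart G) \<Phi>"
    and \<Psi>: "stochastic_flow N \<xi> (biot_savart G) M \<tau> \<Psi>"
  shows "AE (x, \<omega>) in config_measure N \<Otimes>\<^sub>M M. \<forall>t\<in>{0..1}. \<forall>i\<in>{1..N}.
           (\<lambda>m. \<Psi> m \<omega> t x i) \<longlonglongrightarrow> \<Phi> t x i"
proof -
  interpret M: prob_space M by (rule M)
  have G': "smooth_on (- {0}) G"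
    using G by (simp add: green_function_def)
  \<comment> \<open>This set of \<omega> is fixed before x, m and t, so one null set serves them
    all.\<close>
  have good: "AE \<omega> in M. \<omega> \<in> space M \<and> (\<forall>i\<in>{1..}. 0 \<le> \<tau> i \<omega>) \<and> (\<forall>l\<in>{1..N}. \<forall>e>0. \<exists>C. \<forall>k.
      \<bar>\<Sum>i<k. (if i mod N + 1 = l then real N else 0) * (\<tau> (i + 1) \<omega> - 1)\<bar> \<le> e * real k + C)"
    using nonneg M.iid_residue_class_law[OF indep nonneg law mean tails]
    by (auto simp: AE_ball_countable simp del: atLeastAtMost_iff)
  show ?thesis
    using AE_pair_measure_conj[OF prob_space_imp_sigma_finite[OF M] \<Phi>[unfolded vortex_flow_def] good]
  proof (eventually_elim, clarify)
    fix x \<omega> t i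
    assume \<phi>: "vortex_solution N \<xi> (biot_savart G) x (\<lambda>t. \<Phi> t x)" and \<omega>: "\<omega> \<in> space M"
      and \<tau>: "\<forall>i\<in>{1..}. 0 \<le> \<tau> i \<omega>"
      and lln: "\<forall>l\<in>{1..N}. \<forall>e>0. \<exists>C. \<forall>k.
        \<bar>\<Sum>i<k. (if i mod N + 1 = l then real N else 0) * (\<tau> (i + 1) \<omega> - 1)\<bar> \<le> e * real k + C"
      and ti: "t \<in> {0..1::real}" "i \<in> {1..N}"
    \<comment> \<open>A vortex solution lies in \<open>configs N\<close> at time 0, where it equals
      x; this admits x to \<open>stochastic_flow\<close>.\<close>
    have "x \<in> configs N"
      using \<phi> by (force simp: vortex_solution_def)
    then have \<psi>: "interpolated_solution N \<xi> (biot_savart G) (\<lambda>i. \<tau> i \<omega>) m x (\<lambda>t. \<Psi> m \<omega> t x)"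
      if "1 \<le> m" for m
      using \<Psi> \<omega> that by (simp add: stochastic_flow_def)
    show "(\<lambda>m. \<Psi> m \<omega> t x i) \<longlonglongrightarrow> \<Phi> t x i"
      by (rule pathwise_convergence[where \<tau> = "\<lambda>i. \<tau> i \<omega>" and \<phi> = "\<lambda>t. \<Phi> t x" and \<psi> = "\<lambda>m t. \<Psi> m \<omega> t x",
            OF N G' _ _ \<phi> \<psi> ti]) (use \<tau> lln in auto)
  qed
qed

end
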